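(* Assume that: (a) $w^\dagger$ is the unique solution of $\min_{w\in\mathbb{R}^p} R_\alpha(w)$ subject to $Xw=y^\dagger$, and the noiseless dual gradient descent iterates satisfy $v_0^{(k)}\to v^\dagger$, where $v^\dagger$ is a solution of the noiseless dual problem $\min_{v\in\mathbb{R}^n} R_\alpha^*(-X^\top v)+\langle y^\dagger,v\rangle$; (b) $z^\dagger:=-X^\top v^\dagger\in \mathrm{ri}(\partial R_\alpha(w^\dagger))$; (c) $R$ is partly smooth at $w^\dagger$ relative to $\mathcal{M}_{w^\dagger}$, and $\mathcal{M}_{w^\dagger}=w^\dagger+T_{w^\dagger}$ is affine; (d) for a given $\epsilon>0$, with $\mathcal{U}_\epsilon=\bigcup_{w\in\mathcal{M}_{w^\dagger}\cap\mathcal{B}(w^\dagger,\epsilon)}(w+\partial R_\alpha(w))$, the constant $\alpha$ is such that $\alpha c_\delta\|X\|^{-1}<\mathrm{dist}(w^\dagger+z^\dagger,\mathrm{bdy}(\mathcal{U}_\epsilon))$, uniformly in $\delta$, i.e. there is a constant $\bar c$ with $c_\delta\le\bar c$ for all sufficiently small $\delta$ and $\alpha\bar c\,\|X\|^{-1}<\mathrm{dist}(w^\dagger+z^\dagger,\mathrm{bdy}(\mathcal{U}_\epsilon))$; (e) (restricted injectivity) $\ker(X)\cap T_{w^\dagger}=\{0\}$. Let $\delta>0$ be sufficiently small, let $[\underline{k},\overline{k}]$ be the model consistency interval, $k_\delta$ the early stopping time, and $M_{\mathrm{DGD}}$ the matrix defined in the context, with spectral radius $\rho_{M_{\mathrm{DGD}}}$.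 Then: i) $\rho_{M_{\mathrm{DGD}}}<1$. ii) With step size $\gamma=\alpha/\|X\|^2$, for all $k$ with $k-1,k,k+1\in[\underline{k},\overline{k}]$, $$w_\delta^{(k+1)}-w_\delta^{(k)}=M_{\mathrm{DGD}}\big(w_\delta^{(k)}-w_\delta^{(k-1)}\big)+\eta^{(k)},$$ where $\eta^{(k)}=o(\|w_\delta^{(k+1)}-w_\delta^{(\underline{k})}\|)+o(\|w_\delta^{(k)}-w_\delta^{(\underline{k})}\|)+o(\|w_\delta^{(k-1)}-w_\delta^{(\underline{k})}\|)$. iii) If $[\underline{k},\overline{k}]$ contains more than three points (integers), then for every $\rho\in\,]\rho_{M_{\mathrm{DGD}}},1[$ and all $k\in[\underline{k},\overline{k}[$, $$\|w_\delta^{(k+1)}-w_\delta^{(k)}\|\le O(\rho^{\,k-\underline{k}}),$$ i.e. it is bounded by $C\rho^{\,k-\underline{k}}$ with a constant $C>0$ not depending on $k$. iv) For $\rho$ as in iii), there exists a constant $D>0$ such that, for all $k\in[\underline{k},\overline{k}]$, $$\|w_\delta^{(k)}-w^\dagger\|\le d_\delta^\dagger+D\,\rho^{\min\{k,k_\delta\}-\underline{k}}\cdot\frac{1-\rho^{|k-k_\delta|}}{1-\rho}.$$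
   Context: Setting. $X\in\mathbb{R}^{n\times p}$ is a nonzero matrix, $\|X\|$ its operator norm, $w^\dagger\in\mathbb{R}^p$, $y^\dagger=Xw^\dagger$. For each noise level $\delta\in(0,1)$, $y_\delta\in\mathbb{R}^n$ is a noisy observation in the range of $X$ with $\|y_\delta-y^\dagger\|\le\delta$; for $\delta=0$, $y_0=y^\dagger$. $R:\mathbb{R}^p\to\mathbb{R}\cup\{+\infty\}$ is proper, convex and lower semicontinuous; for $\alpha>0$, $R_\alpha(w)=R(w)+\frac{\alpha}{2}\|w\|^2$. $R_\alpha^*$ is the convex conjugate of $R_\alpha$, $\partial$ the convex subdifferential, $\mathrm{prox}_{\gamma R}(w)=\arg\min_{w'}\{R(w')+\frac1{2\gamma}\|w'-w\|^2\}$, $\mathrm{ri}$ the relative interior, $\mathrm{bdy}$ the topological boundary, $\mathcal{B}(w,\epsilon)$ the open ball. Dual gradient descent (DGD). With $\gamma=\alpha\|X\|^{-2}$ and $v_\delta^{(0)}=0$, for $k=0,1,2,\dots$: $z_\delta^{(k)}=-X^\top v_\delta^{(k)}$, $w_\delta^{(k)}=\mathrm{prox}_{\alpha^{-1}R}(\alpha^{-1}z_\delta^{(k)})$, $v_\delta^{(k+1)}=v_\delta^{(k)}+\gamma(Xw_\delta^{(k)}-y_\delta)$. The noiseless iterates $v_0^{(k)}$ are those with $\delta=0$. Early stopping time. Fix $c>0$. For $\delta\in(0,1)$ with $\delta\le c$, $k_\delta$ is an integer chosen in $\{\lfloor c\delta^{-1}\rfloor,\dots,2\lfloor c\delta^{-1}\rfloor\}$,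 and $c_\delta>0$ is defined by $k_\delta=c_\delta\delta^{-1}$. Partial smoothness. For $w$ with $\partial R(w)\neq\emptyset$, $T_w=(\mathrm{span}(\partial R(w)))^\perp$, where for a closed convex set $S$, $\mathrm{span}(S)$ denotes the smallest linear subspace containing $S-x$ for all $x\in S$. $R$ is partly smooth at $w^\dagger$ (with $\partial R(w^\dagger)\ne\emptyset$) relative to a set $\mathcal{M}_{w^\dagger}\ni w^\dagger$ if: (Smoothness) $\mathcal{M}_{w^\dagger}$ is a $C^2$ manifold around $w^\dagger$ and $R|_{\mathcal{M}_{w^\dagger}}$ is $C^2$ near $w^\dagger$; (Sharpness) the tangent space of $\mathcal{M}_{w^\dagger}$ at $w^\dagger$ equals $T_{w^\dagger}$; (Continuity) the set-valued map $\partial R$ is continuous near $w^\dagger$ along $\mathcal{M}_{w^\dagger}$. Model consistency interval. Under (a)–(d), for sufficiently small $\delta$ there are integers $0<\underline{k}<k_\delta<\overline{k}$ such that $w_\delta^{(k)}\in\mathcal{M}_{w^\dagger}$ for all integers $k\in[\underline{k},\overline{k}]$; such an interval is fixed, with these iterates lying in a neighbourhood of $w^\dagger$ in $\mathcal{M}_{w^\dagger}$ on which $R|_{\mathcal{M}_{w^\dagger}}$ is $C^2$. Intervals in $k$ refer to integers. It is supposed that $k_\delta$ is the point of the interval closest to $w^\dagger$: $$d_\delta^\dagger:=\|w_\delta^{(k_\delta)}-w^\dagger\|=\min_{k\in[\underline{k},\overline{k}]}\|w_\delta^{(k)}-w^\dagger\|.$$ The matrix. $P_{T_{w^\dagger}}$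 is the orthogonal projector onto $T_{w^\dagger}$, $X_{T_{w^\dagger}}=XP_{T_{w^\dagger}}$. The Riemannian Hessian of $R$ at $w\in\mathcal{M}_{w^\dagger}$ is $\nabla^2_{\mathcal{M}_{w^\dagger}}R(w)=P_{T_{w^\dagger}}\nabla^2\widetilde R(w)P_{T_{w^\dagger}}$, where $\widetilde R$ is a $C^2$ function agreeing with $R$ on $\mathcal{M}_{w^\dagger}$ (near the points considered). Then $$M_{\mathrm{DGD}}=P_{T_{w^\dagger}}-\frac{1}{\|X\|^2}P_{T_{w^\dagger}}\Big(\mathrm{Id}+\tfrac1\alpha\nabla^2_{\mathcal{M}_{w^\dagger}}R(w_\delta^{(\underline{k})})\Big)^{-1}X_{T_{w^\dagger}}^\top X_{T_{w^\dagger}}.$$ Convention for $o$. $o(\|w-w_\delta^{(\underline{k})}\|)$ denotes a Taylor-type remainder: the value at $w$ of a vector-valued function $\varphi$ defined on $\mathcal{M}_{w^\dagger}$ near $w_\delta^{(\underline{k})}$ with $\|\varphi(w)\|/\|w-w_\delta^{(\underline{k})}\|\to0$ as $w\to w_\delta^{(\underline{k})}$ along $\mathcal{M}_{w^\dagger}$. *)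

theory Defs
  imports "HOL-Analysis.Analysis"
begin

definition proper_fun :: "('a \<Rightarrow> ereal) \<Rightarrow> bool" where
  "proper_fun f \<longleftrightarrow> (\<forall>x. f x \<noteq> -\<infinity>) \<and> (\<exists>x. f x \<noteq> \<infinity>)"

definition convex_fun :: "('a::real_vector \<Rightarrow> ereal) \<Rightarrow> bool" where
  "convex_fun f \<longleftrightarrow> (\<forall>x y t. 0 \<le> t \<and> t \<le> 1 \<longrightarrow>
     f ((1 - t) *\<^sub>R x + t *\<^sub>R y) \<le> ereal (1 - t) * f x + ereal t * f y)"

definition lsc_fun :: "('a::topological_space \<Rightarrow> ereal) \<Rightarrow> bool" where
  "lsc_fun f \<longleftrightarrow> (\<forall>x. f x \<le> Liminf (at x) f)"

definition subdiff :: "('a::real_inner \<Rightarrow> ereal) \<Rightarrow> 'a \<Rightarrow> 'a set" where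
  "subdiff f w = {g. \<forall>w'. f w + ereal (g \<bullet> (w' - w)) \<le> f w'}"

definition conjugate :: "('a::real_inner \<Rightarrow> ereal) \<Rightarrow> 'a \<Rightarrow> ereal" where
  "conjugate f z = (SUP w. ereal (z \<bullet> w) - f w)"

definition prox :: "real \<Rightarrow> ('a::real_inner \<Rightarrow> ereal) \<Rightarrow> 'a \<Rightarrow> 'a" where
  "prox \<gamma> f w = arg_min (\<lambda>w'. f w' + ereal (1 / (2 * \<gamma>) * (norm (w' - w))\<^sup>2)) (\<lambda>_. True)"

definition regularized :: "real \<Rightarrow> ('a::real_inner \<Rightarrow> ereal) \<Rightarrow> 'a \<Rightarrow> ereal" where
  "regularized \<alpha> R w = R w + ereal (\<alpha> / 2 * (norm w)\<^sup>2)"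

text \<open>The distance to a set is extended-real valued, so that the distance to the empty set
  (for instance to the boundary of the whole space) is infinite.\<close>

definition edist_set :: "'a::metric_space \<Rightarrow> 'a set \<Rightarrow> ereal" where
  "edist_set x A = (INF a\<in>A. ereal (dist x a))"

definition opnorm :: "real^'p^'n \<Rightarrow> real" where
  "opnorm X = onorm ((*v) X)"

definition dgd_primal :: "real^'p^'n \<Rightarrow> (real^'p \<Rightarrow> ereal) \<Rightarrow> real \<Rightarrow> real^'n \<Rightarrow> real^'p" where
  "dgd_primal X R \<alpha> v = prox (1 / \<alpha>) R ((1 / \<alpha>) *\<^sub>R (- (transpose X *v v)))"

primrec dgd_v ::
  "real^'p^'n \<Rightarrow> (real^'p \<Rightarrow> ereal) \<Rightarrow> real \<Rightarrow> real^'n \<Rightarrow> nat \<Rightarrow> real^'n" where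
  "dgd_v X R \<alpha> y 0 = 0"
| "dgd_v X R \<alpha> y (Suc k) = dgd_v X R \<alpha> y k
     + (\<alpha> / (opnorm X)\<^sup>2) *\<^sub>R (X *v dgd_primal X R \<alpha> (dgd_v X R \<alpha> y k) - y)"

definition dgd_w ::
  "real^'p^'n \<Rightarrow> (real^'p \<Rightarrow> ereal) \<Rightarrow> real \<Rightarrow> real^'n \<Rightarrow> nat \<Rightarrow> real^'p" where
  "dgd_w X R \<alpha> y k = dgd_primal X R \<alpha> (dgd_v X R \<alpha> y k)"

definition C2_on :: "('a::real_normed_vector \<Rightarrow> 'b::real_normed_vector) \<Rightarrow> 'a set \<Rightarrow> bool" where
  "C2_on f N \<longleftrightarrow> open N \<and>
     (\<exists>(f' :: 'a \<Rightarrow> 'a \<Rightarrow>\<^sub>L 'b) (f'' :: 'a \<Rightarrow> 'a \<Rightarrow>\<^sub>L ('a \<Rightarrow>\<^sub>L 'b)).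
        (\<forall>x\<in>N. (f has_derivative blinfun_apply (f' x)) (at x)) \<and>
        (\<forall>x\<in>N. (f' has_derivative blinfun_apply (f'' x)) (at x)) \<and>
        continuous_on N f'')"

text \<open>Local defining equations of full rank. The codomain of the defining map, of dimension the
  codimension of the manifold, is realized as a linear subspace of the ambient space.\<close>

definition C2_manifold_around :: "'a::euclidean_space set \<Rightarrow> 'a \<Rightarrow> bool" where
  "C2_manifold_around M w \<longleftrightarrow> w \<in> M \<and>
     (\<exists>U W (F :: 'a \<Rightarrow> 'a). w \<in> U \<and> subspace W \<and> C2_on F U \<and> F ` U \<subseteq> W \<and>
        (\<forall>x\<in>U. range (frechet_derivative F (at x)) = W) \<and>
        M \<inter> U = {x\<in>U. F x = 0})"

definition tangent_space :: "'a::euclidean_space set \<Rightarrow> 'a \<Rightarrow> 'a set" where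
  "tangent_space M x = {h. \<exists>(c :: real \<Rightarrow> 'a) r. r > 0 \<and>
     c C1_differentiable_on {-r<..<r} \<and> c ` {-r<..<r} \<subseteq> M \<and> c 0 = x \<and>
     (c has_vector_derivative h) (at 0)}"

definition C2_extension ::
  "('a::real_normed_vector \<Rightarrow> ereal) \<Rightarrow> 'a set \<Rightarrow> 'a set \<Rightarrow> ('a \<Rightarrow> real) \<Rightarrow> bool" where
  "C2_extension R M N Rt \<longleftrightarrow> C2_on Rt N \<and> (\<forall>w\<in>M \<inter> N. R w = ereal (Rt w))"

definition model_space :: "('a::euclidean_space \<Rightarrow> ereal) \<Rightarrow> 'a \<Rightarrow> 'a set" where
  "model_space R w = orthogonal_comp (span {g - h | g h. g \<in> subdiff R w \<and> h \<in> subdiff R w})"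

text \<open>Painleve-Kuratowski continuity relative to a set: outer and inner semicontinuity.\<close>

definition set_map_continuous_at ::
  "('a::topological_space \<Rightarrow> 'b::topological_space set) \<Rightarrow> 'a \<Rightarrow> 'a set \<Rightarrow> bool" where
  "set_map_continuous_at S x M \<longleftrightarrow>
     (\<forall>u g l. (\<forall>n::nat. u n \<in> M) \<and> u \<longlonglongrightarrow> x \<and> (\<forall>n. g n \<in> S (u n)) \<and> g \<longlonglongrightarrow> l \<longrightarrow> l \<in> S x) \<and>
     (\<forall>l\<in>S x. \<forall>u. (\<forall>n::nat. u n \<in> M) \<and> u \<longlonglongrightarrow> x \<longrightarrow>
        (\<exists>g. (\<forall>\<^sub>F n in sequentially. g n \<in> S (u n)) \<and> g \<longlonglongrightarrow> l))"

definition partly_smooth :: "('a::euclidean_space \<Rightarrow> ereal) \<Rightarrow> 'a \<Rightarrow> 'a set \<Rightarrow> bool" where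
  "partly_smooth R w M \<longleftrightarrow> subdiff R w \<noteq> {} \<and> w \<in> M \<and>
     C2_manifold_around M w \<and> (\<exists>N Rt. w \<in> N \<and> C2_extension R M N Rt) \<and>
     tangent_space M w = model_space R w \<and>
     (\<exists>N. open N \<and> w \<in> N \<and> (\<forall>x\<in>M \<inter> N. set_map_continuous_at (subdiff R) x M))"

text \<open>On a linear subspace the nearest-point map is linear, so \<open>matrix\<close> represents it.\<close>

definition orth_projector :: "(real^'p) set \<Rightarrow> real^'p^'p" where
  "orth_projector T = matrix (closest_point T)"

definition gradient :: "(real^'p \<Rightarrow> real) \<Rightarrow> real^'p \<Rightarrow> real^'p" where
  "gradient f x = (\<chi> i. frechet_derivative f (at x) (axis i 1))"

definition hessian :: "(real^'p \<Rightarrow> real) \<Rightarrow> real^'p \<Rightarrow> real^'p^'p" where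
  "hessian f x = matrix (frechet_derivative (gradient f) (at x))"

definition riemannian_hessian ::
  "(real^'p) set \<Rightarrow> (real^'p \<Rightarrow> real) \<Rightarrow> real^'p \<Rightarrow> real^'p^'p" where
  "riemannian_hessian T Rt w = orth_projector T ** hessian Rt w ** orth_projector T"

definition M_DGD ::
  "real^'p^'n \<Rightarrow> real \<Rightarrow> (real^'p) set \<Rightarrow> (real^'p \<Rightarrow> real) \<Rightarrow> real^'p \<Rightarrow> real^'p^'p" where
  "M_DGD X \<alpha> T Rt w =
     (let P = orth_projector T; XT = X ** P in
      P - (1 / (opnorm X)\<^sup>2) *\<^sub>R
        (P ** matrix_inv (mat 1 + (1 / \<alpha>) *\<^sub>R riemannian_hessian T Rt w)
           ** (transpose XT ** XT)))"

definition complex_spectrum :: "real^'p^'p \<Rightarrow> complex set" where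
  "complex_spectrum A = {\<mu>. \<exists>v :: complex^'p. v \<noteq> 0 \<and> map_matrix complex_of_real A *v v = \<mu> *s v}"

definition spectral_radius :: "real^'p^'p \<Rightarrow> real" where
  "spectral_radius A = (SUP \<mu>\<in>complex_spectrum A. cmod \<mu>)"

text \<open>A function of the class $o(\|w - a\|)$ along \<open>M\<close>; as usual for Taylor remainders, the
  value at the base point itself is zero.\<close>

definition little_o_along ::
  "'a::real_normed_vector set \<Rightarrow> 'a \<Rightarrow> ('a \<Rightarrow> 'b::real_normed_vector) \<Rightarrow> bool" where
  "little_o_along M a \<phi> \<longleftrightarrow> \<phi> a = 0 \<and>
     ((\<lambda>w. norm (\<phi> w) / norm (w - a)) \<longlongrightarrow> 0) (at a within M)"

end

theory Submission
  imports Defs "HOL-Computational_Algebra.Fundamental_Theorem_Algebra"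
begin

text \<open>The iterates satisfy \<open>z\<^sub>k - \<alpha> w\<^sub>k \<in> \<partial>R(w\<^sub>k)\<close>, the optimality condition of the proximal step. Along
  the affine manifold this pins down \<open>P \<nabla>Rt(w\<^sub>k) = P(z\<^sub>k - \<alpha> w\<^sub>k)\<close>; linearizing \<open>\<nabla>Rt\<close> at the first
  iterate of the interval and taking second differences in \<open>k\<close> gives the recursion, with the
  Taylor remainder of \<open>\<nabla>Rt\<close> as the only error term.

  Write \<open>S = I + H/\<alpha>\<close> for the restricted Hessian \<open>H\<close>, which is positive semidefinite on \<open>T\<close> because
  \<open>R\<close> is convex, and let \<open>\<mu> \<noteq> 0\<close> be an eigenvalue of \<open>M_DGD\<close> with complex eigenvector \<open>u\<close>. With
  \<open>u\<^sup>* S u = a + ic\<close> and \<open>b = \<parallel>Xu\<parallel>\<^sup>2 / \<parallel>X\<parallel>\<^sup>2\<close> one gets \<open>\<mu> (a + ic) = a + ic - b\<close>. Since \<open>0 < b \<le> a\<close> by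
  restricted injectivity, \<open>\<bar>\<mu>\<bar> < 1\<close>; symmetry of \<open>H\<close> plays no role. The constants of the last two
  claims may depend on \<open>\<delta>\<close>, so they are maxima over the finite interval, and only \<open>\<rho> > 0\<close> is at
  stake, which amounts to the spectrum being nonempty.\<close>

section \<open>Projectors onto subspaces\<close>

text \<open>The variational inequality of the nearest point, tested at its translates by
  \<open>t\<close> and by \<open>- t\<close>, gives both signs of the inner product.\<close>

lemma closest_point_subspace_inner:
  fixes T :: "'a::euclidean_space set"
  assumes T: "subspace T" and t: "t \<in> T"
  shows "(x - closest_point T x) \<bullet> t = 0"
proof -
  have cl: "convex T" "closed T" "T \<noteq> {}"
    using T t subspace_imp_convex closed_subspace by auto
  have "closest_point T x + t \<in> T" "closest_point T x - t \<in> T"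
    using T t closest_point_in_set[OF cl(2,3)] by (auto simp: subspace_add subspace_diff)
  from closest_point_dot[OF cl(1,2) this(1), of x] closest_point_dot[OF cl(1,2) this(2), of x]
  show ?thesis by simp
qed

lemma closest_point_subspace_unique:
  fixes T :: "'a::euclidean_space set"
  assumes T: "subspace T" and p: "p \<in> T" "\<And>t. t \<in> T \<Longrightarrow> (x - p) \<bullet> t = 0"
  shows "closest_point T x = p"
proof -
  have d: "closest_point T x - p \<in> T"
    using T p closest_point_in_set[of T x] closed_subspace[OF T] by (auto intro: subspace_diff)
  have "(closest_point T x - p) \<bullet> (closest_point T x - p) =
     (x - p) \<bullet> (closest_point T x - p) - (x - closest_point T x) \<bullet> (closest_point T x - p)"
    by (simp add: inner_diff_left)
  also have "\<dots> = 0"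
    using p(2)[OF d] closest_point_subspace_inner[OF T d] by simp
  finally show ?thesis by simp
qed

lemma linear_closest_point:
  fixes T :: "'a::euclidean_space set"
  assumes T: "subspace T"
  shows "linear (closest_point T)"
proof (rule linearI)
  have in_T: "closest_point T x \<in> T" for x
    using closest_point_in_set[of T x] closed_subspace[OF T] subspace_0[OF T] by auto
  note orth = closest_point_subspace_inner[OF T]
  show "closest_point T (x + y) = closest_point T x + closest_point T y" for x y
    using T in_T orth[of _ x] orth[of _ y]
    by (intro closest_point_subspace_unique) (auto simp: subspace_add algebra_simps inner_simps)
  show "closest_point T (r *\<^sub>R x) = r *\<^sub>R closest_point T x" for r x
    using T in_T orth[of _ x]
    by (intro closest_point_subspace_unique) (auto simp: subspace_scale inner_simps)
qed

text \<open>The projector is defined through the nearest-point map; the later algebra with it rests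
  on these three facts.\<close>

lemma orth_projector_properties:
  fixes T :: "(real^'p) set"
  assumes T: "subspace T"
  shows orth_projector_mem: "orth_projector T *v x \<in> T"
    and orth_projector_id: "t \<in> T \<Longrightarrow> orth_projector T *v t = t"
    and orth_projector_sym: "(orth_projector T *v x) \<bullet> y = x \<bullet> (orth_projector T *v y)"
proof -
  have P: "orth_projector T *v x = closest_point T x" for x
    unfolding orth_projector_def by (simp add: matrix_works linear_closest_point[OF T])
  show mem: "orth_projector T *v x \<in> T" for x
    unfolding P using closest_point_in_set[of T x] closed_subspace[OF T] subspace_0[OF T] by auto
  have inn: "t \<in> T \<Longrightarrow> (orth_projector T *v x) \<bullet> t = x \<bullet> t" for t x
    unfolding P using closest_point_subspace_inner[OF T, of t x] by (simp add: inner_diff_left)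
  show id: "t \<in> T \<Longrightarrow> orth_projector T *v t = t" for t
    unfolding P by (simp add: closest_point_self)
  show "(orth_projector T *v x) \<bullet> y = x \<bullet> (orth_projector T *v y)" for x y
    by (metis inn inner_commute mem)
qed

section \<open>Spectral radius\<close>

text \<open>A determinant-free argument: some nonzero polynomial in the matrix annihilates a nonzero
  vector, and splitting off its linear factors one by one exposes an eigenvector.\<close>

lemma complex_spectrum_nonempty:
  fixes A :: "real^'p^'p"
  shows "complex_spectrum A \<noteq> {}"
proof -
  define B where "B = map_matrix complex_of_real A"
  define f where "f = (\<lambda>v. B *v v)"
  \<comment> \<open>\<open>ev p v\<close> is the polynomial \<open>p\<close>, evaluated at the map
    \<open>f\<close> in Horner form and applied to \<open>v\<close>.\<close>
  define ev where "ev = (\<lambda>p v. fold_coeffs (\<lambda>a s. a *s v + f s) p 0)"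
  have f0: "f 0 = 0" and f_add: "f (u + v) = f u + f v" and f_scale: "f (c *s u) = c *s f u" for u v c
    unfolding f_def by (simp_all add: matrix_vector_right_distrib vector_scalar_commute)
  have ev_0: "ev 0 v = 0" for v
    by (simp add: ev_def)
  have ev_pCons: "ev (pCons a p) v = a *s v + f (ev p v)" for a p v
    unfolding ev_def by (cases "a = 0 \<and> p = 0") (auto simp: fold_coeffs_pCons_eq f0)
  have ev_add: "ev (p + q) v = ev p v + ev q v" for p q v
  proof (induction p arbitrary: q)
    case 0
    then show ?case by (simp add: ev_0)
  next
    case (pCons a p)
    show ?case
      by (cases q) (simp add: ev_pCons pCons.IH f_add vector_sadd_rdistrib)
  qed
  have ev_smult: "ev (smult c p) v = c *s ev p v" for c p v
    by (induction p) (simp_all add: ev_0 ev_pCons f_scale vector_add_ldistrib vector_smult_assoc)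
  \<comment> \<open>Induction on the degree. If \<open>p\<close> is \<open>q\<close> times the
    linear factor of a root \<open>z\<close>, then either \<open>ev q v\<close> is an eigenvector
    for \<open>z\<close>, or \<open>q\<close> annihilates \<open>v\<close> as well and has smaller
    degree.\<close>
  have main: "\<exists>\<mu> u. u \<noteq> 0 \<and> f u = \<mu> *s u" if "p \<noteq> 0" "v \<noteq> 0" "ev p v = 0" for p v
    using that
  proof (induction "degree p" arbitrary: p)
    case 0
    then obtain a where "p = [:a:]" by (metis degree_eq_zeroE)
    with 0 show ?case by (simp add: ev_pCons ev_0 f0)
  next
    case (Suc n)
    then have "\<not> constant (poly p)"
      by (simp add: constant_degree)
    then obtain z where "poly p z = 0"
      using fundamental_theorem_of_algebra by blast
    then obtain q where q: "p = [:-z, 1:] * q"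
      by (auto simp: poly_eq_0_iff_dvd)
    have "q \<noteq> 0" using q Suc.prems by auto
    then have deg: "n = degree q"
      using degree_mult_eq[of "[:-z, 1:]" q] q Suc.hyps(2) by simp
    have "p = pCons 0 q + smult (-z) q"
      using q by simp
    then have "ev p v = f (ev q v) + (-z) *s ev q v"
      by (simp only: ev_add ev_smult ev_pCons) simp
    then have *: "f (ev q v) = z *s ev q v"
      using Suc.prems(3) by simp
    show ?case
    proof (cases "ev q v = 0")
      case True
      then show ?thesis using Suc.hyps(1)[OF deg] \<open>q \<noteq> 0\<close> Suc.prems by blast
    next
      case False
      then show ?thesis using * by blast
    qed
  qed
  define v :: "complex^'p" where "v = 1"
  have v: "v \<noteq> 0" by (simp add: v_def)
  have ev_monom: "ev (monom c n) v = c *s (f ^^ n) v" for c n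
    by (induction n) (simp_all add: monom_0 monom_Suc ev_pCons ev_0 f0 f_scale)
  have ev_sum: "ev (\<Sum>i\<in>I. g i) v = (\<Sum>i\<in>I. ev (g i) v)" for g and I :: "nat set"
    by (induction I rule: infinite_finite_induct) (auto simp: ev_0 ev_add)
  \<comment> \<open>If two Krylov vectors \<open>(f ^^ i) v\<close> coincide, a difference of two
    monomials annihilates \<open>v\<close>. Otherwise one more of them than the real dimension form
    a dependent set, and the real coefficients of the dependence give the polynomial.\<close>
  have "\<exists>p. p \<noteq> 0 \<and> ev p v = 0"
  proof (cases "inj (\<lambda>i. (f ^^ i) v)")
    case False
    then obtain i j where ij: "i \<noteq> j" "(f ^^ i) v = (f ^^ j) v"
      by (auto simp: inj_def)
    have "coeff (monom 1 i + monom (-1::complex) j) i \<noteq> 0"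
      using ij(1) by simp
    then have "monom 1 i + monom (-1::complex) j \<noteq> 0" by force
    moreover have "ev (monom 1 i + monom (-1) j) v = 0"
      using ij(2) by (simp add: ev_add ev_monom)
    ultimately show ?thesis by blast
  next
    case True
    let ?g = "\<lambda>i. (f ^^ i) v"
    have inj: "inj_on ?g {..DIM(complex^'p)}"
      using True by (rule inj_on_subset) simp
    have "dependent (?g ` {..DIM(complex^'p)})"
      by (rule dependent_biggerset) (simp only: card_image[OF inj] card_atMost lessI)
    then obtain u where u: "\<exists>x\<in>?g ` {..DIM(complex^'p)}. u x \<noteq> 0"
        "(\<Sum>x\<in>?g ` {..DIM(complex^'p)}. u x *\<^sub>R x) = 0"
      by (subst (asm) dependent_finite) auto
    define p where "p = (\<Sum>i\<le>DIM(complex^'p). monom (complex_of_real (u (?g i))) i)"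
    from u(1) obtain i where i: "i \<le> DIM(complex^'p)" "u (?g i) \<noteq> 0" by auto
    have "coeff p i = complex_of_real (u (?g i))"
      using i(1) by (simp add: p_def coeff_sum sum.delta)
    then have "p \<noteq> 0" using i(2) by auto
    have sc: "complex_of_real r *s w = r *\<^sub>R w" for r and w :: "complex^'p"
      by (simp add: vec_eq_iff scaleR_conv_of_real[where 'a = complex])
    have "ev p v = (\<Sum>i\<le>DIM(complex^'p). u (?g i) *\<^sub>R ?g i)"
      by (simp add: p_def ev_sum ev_monom sc)
    also have "\<dots> = 0"
      using u(2) unfolding sum.reindex[OF inj] comp_def .
    finally show ?thesis using \<open>p \<noteq> 0\<close> by blast
  qed
  with main v obtain \<mu> u where "u \<noteq> 0" "f u = \<mu> *s u" by blast
  then show ?thesis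
    unfolding complex_spectrum_def f_def B_def by blast
qed

text \<open>Here \<open>S\<close> stands for the identity plus the scaled Hessian and
  \<open>Q\<close> for \<open>X\<close> divided by its norm. A supremum is to be bounded strictly,
  so the gap to 1 must not depend on the eigenvalue; it is built from a lower bound of
  \<open>Q\<close> on \<open>T\<close> and an upper bound of \<open>S\<close>.\<close>

lemma spectral_radius_less_one:
  fixes A S :: "real^'p^'p" and Q :: "real^'p^'n"
  assumes T: "subspace T" and range: "\<And>v. A *v v \<in> T"
    and coercive: "\<And>u. u \<in> T \<Longrightarrow> (norm u)\<^sup>2 \<le> u \<bullet> (S *v u)"
    and SA: "\<And>x u. x \<in> T \<Longrightarrow> u \<in> T \<Longrightarrow> x \<bullet> (S *v (A *v u)) = x \<bullet> (S *v u) - (Q *v x) \<bullet> (Q *v u)"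
    and contr: "\<And>u. u \<in> T \<Longrightarrow> norm (Q *v u) \<le> norm u"
    and inj: "\<And>u. u \<in> T \<Longrightarrow> Q *v u = 0 \<Longrightarrow> u = 0"
  shows "spectral_radius A < 1"
proof -
  obtain \<beta> where \<beta>: "\<beta> > 0" "\<And>u. u \<in> T \<Longrightarrow> \<beta> * norm u \<le> norm (Q *v u)"
    using injective_imp_isometric[of T "(*v) Q"] closed_subspace[OF T] T inj
      matrix_vector_mul_bounded_linear by blast
  obtain \<kappa> where \<kappa>: "\<kappa> > 0" "\<And>u. norm (S *v u) \<le> \<kappa> * norm u"
    using linear_bounded_pos[of "(*v) S"] by auto
  have bilin: "\<bar>x \<bullet> (S *v u)\<bar> \<le> \<kappa> * norm x * norm u" for x u
    using Cauchy_Schwarz_ineq2[of x "S *v u"] mult_left_mono[OF \<kappa>(2)[of u], of "norm x"]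
    by (simp add: algebra_simps)
  \<comment> \<open>Below, (1 - \<open>(cmod \<mu>)\<^sup>2\<close>)
    (\<open>a\<^sup>2 + c\<^sup>2\<close>) = \<open>b * (2 * a - b)\<close>. The right side is at
    least \<open>\<beta>\<^sup>2 * n * n\<close> and \<open>a\<^sup>2 + c\<^sup>2\<close> is at most
    \<open>2 * (\<kappa> * n)\<^sup>2\<close>; \<open>q\<close> is the quotient of these
    bounds.\<close>
  define q where "q = \<beta>\<^sup>2 / (2 * \<kappa>\<^sup>2)"
  have q: "q > 0" using \<beta>(1) \<kappa>(1) by (simp add: q_def)
  have bound: "(cmod \<mu>)\<^sup>2 \<le> 1 - q" if \<mu>: "\<mu> \<in> complex_spectrum A" "\<mu> \<noteq> 0" for \<mu>
  proof -
    obtain v :: "complex^'p" where v: "v \<noteq> 0" "map_matrix complex_of_real A *v v = \<mu> *s v"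
      using \<mu>(1) by (auto simp: complex_spectrum_def)
    define u1 :: "real^'p" where "u1 = (\<chi> i. Re (v $ i))"
    define u2 :: "real^'p" where "u2 = (\<chi> i. Im (v $ i))"
    have "(\<Sum>j\<in>UNIV. complex_of_real (A $ i $ j) * v $ j) = \<mu> * v $ i" for i
      using v(2) by (simp add: vec_eq_iff matrix_vector_mult_def map_matrix_def)
    from arg_cong[OF this, of Re] arg_cong[OF this, of Im]
    have A1: "A *v u1 = Re \<mu> *\<^sub>R u1 - Im \<mu> *\<^sub>R u2" and A2: "A *v u2 = Im \<mu> *\<^sub>R u1 + Re \<mu> *\<^sub>R u2"
      by (simp_all add: vec_eq_iff u1_def u2_def matrix_vector_mult_def add.commute)
    have \<mu>0: "(Re \<mu>)\<^sup>2 + (Im \<mu>)\<^sup>2 \<noteq> 0"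
      using \<mu>(2) by (simp add: complex_eq_iff sum_power2_eq_zero_iff)
    \<comment> \<open>The eigenvalue equation times the conjugate of \<open>\<mu>\<close>, split
      into real and imaginary parts. The left sides lie in \<open>T\<close>, hence so do both parts
      of the eigenvector, as \<open>\<mu>\<close> is nonzero.\<close>
    have "Re \<mu> *\<^sub>R (A *v u1) + Im \<mu> *\<^sub>R (A *v u2) = ((Re \<mu>)\<^sup>2 + (Im \<mu>)\<^sup>2) *\<^sub>R u1"
      "Re \<mu> *\<^sub>R (A *v u2) - Im \<mu> *\<^sub>R (A *v u1) = ((Re \<mu>)\<^sup>2 + (Im \<mu>)\<^sup>2) *\<^sub>R u2"
      by (simp_all add: A1 A2 algebra_simps power2_eq_square)
    then have "((Re \<mu>)\<^sup>2 + (Im \<mu>)\<^sup>2) *\<^sub>R u1 \<in> T" "((Re \<mu>)\<^sup>2 + (Im \<mu>)\<^sup>2) *\<^sub>R u2 \<in> T"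
      using T range by (metis subspace_add subspace_scale, metis subspace_diff subspace_scale)
    then have u: "u1 \<in> T" "u2 \<in> T"
      using subspace_scale[OF T, of _ "inverse ((Re \<mu>)\<^sup>2 + (Im \<mu>)\<^sup>2)"] \<mu>0 by force+
    \<comment> \<open>For the complex vector u = \<open>u1\<close> + i \<open>u2\<close>:
      \<open>n\<close> is its squared norm, \<open>a\<close> + i \<open>c\<close> is u* S u, and
      \<open>b\<close> is the squared norm of Q u. The equations \<open>eq1\<close> and
      \<open>eq2\<close> are the real and imaginary parts of the identity obtained by testing
      \<open>SA\<close> with u.\<close>
    define n where "n = (norm u1)\<^sup>2 + (norm u2)\<^sup>2"
    define a where "a = u1 \<bullet> (S *v u1) + u2 \<bullet> (S *v u2)"
    define c where "c = u1 \<bullet> (S *v u2) - u2 \<bullet> (S *v u1)"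
    define b where "b = (norm (Q *v u1))\<^sup>2 + (norm (Q *v u2))\<^sup>2"
    have "u1 \<noteq> 0 \<or> u2 \<noteq> 0"
      using v(1) by (auto simp: vec_eq_iff u1_def u2_def complex_eq_iff)
    then have n: "n > 0" by (auto simp: n_def add_pos_nonneg add_nonneg_pos)
    have eq1: "Re \<mu> * a - Im \<mu> * c = a - b"
      using SA[OF u(1) u(1)] SA[OF u(2) u(2)]
      by (simp add: A1 A2 a_def b_def c_def matrix_vector_right_distrib matrix_vector_mult_diff_distrib
          matrix_vector_mult_scaleR inner_simps power2_norm_eq_inner algebra_simps)
    have eq2: "Re \<mu> * c + Im \<mu> * a = c"
      using SA[OF u(1) u(2)] SA[OF u(2) u(1)]
      by (simp add: A1 A2 a_def b_def c_def matrix_vector_right_distrib matrix_vector_mult_diff_distrib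
          matrix_vector_mult_scaleR inner_simps inner_commute[of "Q *v u2" "Q *v u1"] algebra_simps)
    have mod: "(cmod \<mu>)\<^sup>2 * (a\<^sup>2 + c\<^sup>2) = (a - b)\<^sup>2 + c\<^sup>2"
    proof -
      have "(cmod \<mu>)\<^sup>2 * (a\<^sup>2 + c\<^sup>2) = (Re \<mu> * a - Im \<mu> * c)\<^sup>2 + (Re \<mu> * c + Im \<mu> * a)\<^sup>2"
        unfolding cmod_power2 by (simp add: power2_eq_square algebra_simps)
      then show ?thesis by (simp only: eq1 eq2)
    qed
    have a_ge: "n \<le> a" using coercive[OF u(1)] coercive[OF u(2)] by (simp add: n_def a_def)
    have b_le: "b \<le> n" using contr[OF u(1)] contr[OF u(2)]
      by (simp add: n_def b_def add_mono power_mono)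
    have b_ge: "\<beta>\<^sup>2 * n \<le> b"
      using power_mono[OF \<beta>(2)[OF u(1)], of 2] power_mono[OF \<beta>(2)[OF u(2)], of 2] \<beta>(1)
      by (simp add: n_def b_def power_mult_distrib algebra_simps)
    have a_le: "a \<le> \<kappa> * n"
      using bilin[of u1 u1] bilin[of u2 u2] by (simp add: a_def n_def power2_eq_square algebra_simps)
    have "2 * norm u1 * norm u2 \<le> n"
      unfolding n_def by (rule sum_squares_bound)
    then have "\<kappa> * (2 * norm u1 * norm u2) \<le> \<kappa> * n"
      using \<kappa>(1) by (intro mult_left_mono) auto
    then have c_le: "\<bar>c\<bar> \<le> \<kappa> * n"
      using bilin[of u1 u2] bilin[of u2 u1] unfolding c_def by (simp add: algebra_simps)
    have ac: "a\<^sup>2 + c\<^sup>2 \<le> 2 * (\<kappa> * n)\<^sup>2"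
      using power_mono[OF a_le, of 2] power_mono[OF c_le, of 2] a_ge n by simp
    have "q * (a\<^sup>2 + c\<^sup>2) \<le> q * (2 * (\<kappa> * n)\<^sup>2)"
      using ac q by (intro mult_left_mono) auto
    also have "\<dots> = \<beta>\<^sup>2 * n * n"
      using \<kappa>(1) by (simp add: q_def field_simps power2_eq_square)
    also have "\<dots> \<le> b * (2 * a - b)"
      using b_ge b_le a_ge n by (intro mult_mono) (auto simp: b_def)
    finally have "((cmod \<mu>)\<^sup>2 - (1 - q)) * (a\<^sup>2 + c\<^sup>2) \<le> 0"
      using mod by (simp add: algebra_simps power2_eq_square)
    moreover have "a\<^sup>2 + c\<^sup>2 > 0" using a_ge n by (simp add: add_pos_nonneg)
    ultimately show ?thesis by (simp add: mult_le_0_iff)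
  qed
  \<comment> \<open>The maximum with 0 is taken since \<open>1 - q\<close> may be negative: when
    \<open>T\<close> is trivial, nothing bounds \<open>\<beta>\<close> from above.\<close>
  have "cmod \<mu> \<le> sqrt (max 0 (1 - q))" if "\<mu> \<in> complex_spectrum A" for \<mu>
  proof (cases "\<mu> = 0")
    case False
    then show ?thesis using bound[OF that] by (intro real_le_rsqrt) auto
  qed simp
  then have "spectral_radius A \<le> sqrt (max 0 (1 - q))"
    unfolding spectral_radius_def using complex_spectrum_nonempty by (intro cSUP_least) auto
  also have "\<dots> < 1" using q by simp
  finally show ?thesis .
qed

lemma bdd_above_complex_spectrum:
  fixes A :: "real^'p^'p"
  shows "bdd_above (cmod ` complex_spectrum A)"
proof -
  obtain B where B: "B > 0" "\<And>v :: complex^'p. norm (map_matrix complex_of_real A *v v) \<le> B * norm v"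
    using linear_bounded_pos[OF matrix_vector_mul_linear, of "map_matrix complex_of_real A"] by blast
  have "cmod \<mu> \<le> B" if \<mu>: "\<mu> \<in> complex_spectrum A" for \<mu>
  proof -
    obtain v :: "complex^'p" where v: "v \<noteq> 0" "map_matrix complex_of_real A *v v = \<mu> *s v"
      using \<mu> by (auto simp: complex_spectrum_def)
    have "norm (\<mu> *s v) = cmod \<mu> * norm v"
      by (simp add: norm_vec_def norm_mult L2_set_right_distrib)
    then show ?thesis using B(2)[of v] v by simp
  qed
  then show ?thesis by (auto intro!: bdd_aboveI2)
qed

text \<open>Yields positivity of every admissible rate \<open>\<rho>\<close>. The supremum is over a
  nonempty bounded set, so it dominates the modulus of an actual eigenvalue.\<close>

lemma spectral_radius_nonneg: "0 \<le> spectral_radius A"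
proof -
  obtain \<mu> where \<mu>: "\<mu> \<in> complex_spectrum A" using complex_spectrum_nonempty by blast
  have "0 \<le> cmod \<mu>" by simp
  also have "\<dots> \<le> spectral_radius A"
    unfolding spectral_radius_def by (rule cSUP_upper[OF \<mu> bdd_above_complex_spectrum])
  finally show ?thesis .
qed

section \<open>The proximal operator\<close>

text \<open>If every \<open>x\<close> in \<open>K\<close> had a strictly better point
  \<open>s x\<close>, lower semicontinuity would keep \<open>f (s x)\<close> below \<open>f\<close>
  on a neighbourhood of \<open>x\<close>. In a finite subcover, the best of the points
  \<open>s x\<close> would lie in one of these neighbourhoods and be beaten again.\<close>

lemma lsc_fun_attains_inf:
  fixes f :: "'a::topological_space \<Rightarrow> ereal"
  assumes f: "lsc_fun f" and K: "compact K" "K \<noteq> {}"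
  shows "\<exists>x\<in>K. \<forall>y\<in>K. f x \<le> f y"
proof (rule ccontr)
  assume "\<not> ?thesis"
  then obtain s where s: "s x \<in> K" "f (s x) < f x" if "x \<in> K" for x
    by (metis not_le)
  have "\<exists>V. open V \<and> x \<in> V \<and> (\<forall>z\<in>V. f (s x) < f z)" if x: "x \<in> K" for x
  proof -
    have "f (s x) < Liminf (at x) f"
      using f s(2)[OF x] unfolding lsc_fun_def by (meson less_le_trans)
    then have "\<forall>\<^sub>F z in at x. f (s x) < f z"
      by (metis le_Liminf_iff order_refl)
    then obtain V where V: "open V" "x \<in> V" "\<forall>z\<in>V. z \<noteq> x \<longrightarrow> f (s x) < f z"
      unfolding eventually_at_topological by blast
    \<comment> \<open>\<open>Liminf (at x)\<close> concerns punctured neighbourhoods only; the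
      centre is covered by the choice of \<open>s x\<close>.\<close>
    then have "\<forall>z\<in>V. f (s x) < f z" using s(2)[OF x] by metis
    then show ?thesis using V by blast
  qed
  then have "\<forall>x\<in>K. \<exists>V. open V \<and> x \<in> V \<and> (\<forall>z\<in>V. f (s x) < f z)" by blast
  from bchoice[OF this] obtain V
    where V: "\<forall>x\<in>K. open (V x) \<and> x \<in> V x \<and> (\<forall>z\<in>V x. f (s x) < f z)" ..
  then have "K \<subseteq> (\<Union>x\<in>K. V x)" by blast
  then obtain D where D: "D \<subseteq> K" "finite D" "K \<subseteq> (\<Union>x\<in>D. V x)"
    using compactE_image[OF K(1), of K V] V by metis
  have "D \<noteq> {}" using D(3) K(2) by auto
  then have "Min ((\<lambda>x. f (s x)) ` D) \<in> (\<lambda>x. f (s x)) ` D"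
    using D(2) by (intro Min_in) auto
  then obtain x where x: "x \<in> D" "f (s x) = Min ((\<lambda>x. f (s x)) ` D)" by auto
  then have min: "f (s x) \<le> f (s z)" if "z \<in> D" for z
    using D(2) that by simp
  have "s x \<in> K" using s x(1) D(1) by blast
  then obtain z where z: "z \<in> D" "s x \<in> V z" using D(3) by blast
  then have "f (s z) < f (s x)" using V D(1) by blast
  then show False using min[OF z(1)] by simp
qed

lemma lsc_fun_add_continuous:
  fixes f :: "'a::topological_space \<Rightarrow> ereal"
  assumes f: "lsc_fun f" and q: "continuous_on UNIV q"
  shows "lsc_fun (\<lambda>x. f x + ereal (q x))"
  unfolding lsc_fun_def
proof
  fix x
  show "f x + ereal (q x) \<le> Liminf (at x) (\<lambda>x. f x + ereal (q x))"
  proof (subst le_Liminf_iff, intro allI impI)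
    fix y assume y: "y < f x + ereal (q x)"
    have "(q \<longlongrightarrow> q x) (at x)" using q by (simp add: continuous_on_def)
    \<comment> \<open>A margin \<open>e\<close> to be absorbed by the oscillation of
      \<open>q\<close>: half the gap if both values are finite, and 1 in the infinite cases.\<close>
    obtain e where e: "e > 0" "y + ereal e < f x + ereal (q x)"
    proof (cases y; cases "f x")
      fix a b assume *: "y = ereal a" "f x = ereal b"
      then have "b + q x - a > 0" using y by simp
      then show thesis using * by (intro that[of "(b + q x - a) / 2"]) (auto simp: field_simps)
    qed (use y in \<open>auto intro: that[of 1]\<close>)
    have "y + ereal e - ereal (q x) < f x"
      using e(2) by (cases y; cases "f x") auto
    also have "f x \<le> Liminf (at x) f" using f by (simp add: lsc_fun_def)
    finally have "\<forall>\<^sub>F z in at x. y + ereal e - ereal (q x) < f z"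
      by (metis le_Liminf_iff order_refl)
    moreover have "\<forall>\<^sub>F z in at x. q z > q x - e"
      using order_tendstoD(1)[OF \<open>(q \<longlongrightarrow> q x) (at x)\<close>, of "q x - e"] e(1) by simp
    ultimately show "\<forall>\<^sub>F z in at x. y < f z + ereal (q z)"
    proof eventually_elim
      case (elim z)
      then show ?case by (cases y; cases "f z") auto
    qed
  qed
qed

lemma subdiff_finite:
  assumes "proper_fun R" "g \<in> subdiff R w"
  obtains r where "R w = ereal r"
proof -
  obtain x where "R x \<noteq> \<infinity>" using assms(1) by (auto simp: proper_fun_def)
  moreover have "R w + ereal (g \<bullet> (x - w)) \<le> R x" using assms(2) by (simp add: subdiff_def)
  ultimately have "R w \<noteq> \<infinity>" by auto
  moreover have "R w \<noteq> -\<infinity>" using assms(1) by (simp add: proper_fun_def)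
  ultimately show thesis using that by (cases "R w") auto
qed

text \<open>\<open>arg_min\<close> is a choice operator, so a minimizer has to be exhibited. The
  subgradient \<open>g\<close> gives an affine minorant, the quadratic term then makes the objective
  coercive, and lower semicontinuity provides a minimizer on a large ball.\<close>

lemma prox_attained:
  fixes R :: "'a::euclidean_space \<Rightarrow> ereal"
  assumes R: "proper_fun R" "lsc_fun R" and g: "g \<in> subdiff R w0" and \<gamma>: "\<gamma> > 0"
  shows "R (prox \<gamma> R a) + ereal (1 / (2 * \<gamma>) * (norm (prox \<gamma> R a - a))\<^sup>2)
    \<le> R w + ereal (1 / (2 * \<gamma>) * (norm (w - a))\<^sup>2)"
proof -
  define c where "c = 1 / (2 * \<gamma>)"
  define f where "f = (\<lambda>w. R w + ereal (c * (norm (w - a))\<^sup>2))"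
  have c: "c > 0" using \<gamma> by (simp add: c_def)
  obtain r where r: "R w0 = ereal r" using subdiff_finite[OF R(1) g] .
  define d where "d = norm (w0 - a)"
  \<comment> \<open>At distance \<open>?s\<close> at least \<open>B\<close> from \<open>a\<close>
    one has \<open>norm g \<le> c * (?s - d)\<close>; multiplied by \<open>?s + d\<close>, this lets
    the quadratic growth dominate the linear loss.\<close>
  define B where "B = d + norm g / c"
  have far: "f w0 \<le> f w" if w: "norm (w - a) \<ge> B" for w
  proof -
    let ?s = "norm (w - a)"
    have "norm g \<le> c * (?s - d)"
      using w c by (simp add: B_def field_simps)
    then have "norm g * (?s + d) \<le> c * (?s - d) * (?s + d)"
      by (intro mult_right_mono) (auto simp: d_def)
    moreover have "norm (w - w0) \<le> ?s + d"
      unfolding d_def using norm_triangle_ineq4[of "w - a" "w0 - a"] by simp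
    then have "- (g \<bullet> (w - w0)) \<le> norm g * (?s + d)"
      using Cauchy_Schwarz_ineq2[of g "w - w0"]
      by (smt (verit, best) mult_left_mono norm_ge_zero)
    ultimately have "r + c * d\<^sup>2 \<le> r + g \<bullet> (w - w0) + c * ?s\<^sup>2"
      by (simp add: power2_eq_square algebra_simps)
    then have "f w0 \<le> (R w0 + ereal (g \<bullet> (w - w0))) + ereal (c * ?s\<^sup>2)"
      by (simp add: f_def r d_def)
    also have "\<dots> \<le> f w"
      using g unfolding f_def subdiff_def by (intro add_right_mono) simp
    finally show ?thesis .
  qed
  have "lsc_fun f"
    unfolding f_def by (intro lsc_fun_add_continuous R continuous_intros)
  moreover have w0: "w0 \<in> cball a B"
    using c by (simp add: B_def d_def dist_norm norm_minus_commute)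
  ultimately have "\<exists>p\<in>cball a B. \<forall>w\<in>cball a B. f p \<le> f w"
    by (intro lsc_fun_attains_inf compact_cball) blast+
  then obtain p where p: "\<And>w. w \<in> cball a B \<Longrightarrow> f p \<le> f w" by blast
  have "f p \<le> f w" for w
  proof (cases "w \<in> cball a B")
    case False
    then have "f w0 \<le> f w" by (intro far) (simp add: dist_norm norm_minus_commute)
    then show ?thesis using p[OF w0] by simp
  qed (rule p)
  then have "is_arg_min f (\<lambda>_. True) p"
    by (simp add: is_arg_min_def not_less)
  then have "is_arg_min f (\<lambda>_. True) (prox \<gamma> R a)"
    unfolding prox_def arg_min_def f_def c_def by (rule someI)
  then show ?thesis
    by (simp add: is_arg_min_def not_less f_def c_def)
qed

text \<open>Fermat's rule by hand: compare the minimizer \<open>p\<close> with the points of the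
  segment towards \<open>w\<close>, bound \<open>R\<close> there by convexity, divide by
  \<open>t\<close> and let \<open>t\<close> tend to 0 from the right.\<close>

lemma prox_subdiff:
  fixes R :: "'a::euclidean_space \<Rightarrow> ereal"
  assumes R: "proper_fun R" "convex_fun R" "lsc_fun R" and g: "g \<in> subdiff R w0" and \<gamma>: "\<gamma> > 0"
  shows "(1 / \<gamma>) *\<^sub>R (a - prox \<gamma> R a) \<in> subdiff R (prox \<gamma> R a)"
proof -
  define p where "p = prox \<gamma> R a"
  note min = prox_attained[OF R(1,3) g \<gamma>, of a, folded p_def]
  obtain r0 where "R w0 = ereal r0" using subdiff_finite[OF R(1) g] .
  then have "R p \<noteq> \<infinity>" using min[of w0] by auto
  moreover have R_ninf: "R x \<noteq> -\<infinity>" for x using R(1) by (simp add: proper_fun_def)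
  ultimately obtain r where r: "R p = ereal r" by (cases "R p") auto
  have "R p + ereal (((1 / \<gamma>) *\<^sub>R (a - p)) \<bullet> (w - p)) \<le> R w" for w
  proof (cases "R w")
    case (real s)
    define h where "h = w - p"
    define c where "c = 1 / (2 * \<gamma>)"
    have step: "2 * c * ((a - p) \<bullet> h) \<le> s - r + t * (c * (norm h)\<^sup>2)"
      if t: "0 < t" "t < 1" for t
    proof -
      have e: "(1 - t) *\<^sub>R p + t *\<^sub>R w = p + t *\<^sub>R h" by (simp add: h_def algebra_simps)
      have "R (p + t *\<^sub>R h) \<le> ereal ((1 - t) * r + t * s)"
        using R(2)[unfolded convex_fun_def, rule_format, of t p w] t by (simp add: r real e)
      then have "R p + ereal (1 / (2 * \<gamma>) * (norm (p - a))\<^sup>2) \<le>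
          ereal ((1 - t) * r + t * s) + ereal (1 / (2 * \<gamma>) * (norm (p + t *\<^sub>R h - a))\<^sup>2)"
        using min[of "p + t *\<^sub>R h"] by (meson add_right_mono order_trans)
      moreover have "(norm (p + t *\<^sub>R h - a))\<^sup>2 = (norm (p - a))\<^sup>2 - 2 * t * ((a - p) \<bullet> h) + t\<^sup>2 * (norm h)\<^sup>2"
        unfolding power2_norm_eq_inner by (simp add: inner_simps inner_commute power2_eq_square algebra_simps)
      ultimately have "r + c * (norm (p - a))\<^sup>2 \<le> (1 - t) * r + t * s +
          c * ((norm (p - a))\<^sup>2 - 2 * t * ((a - p) \<bullet> h) + t\<^sup>2 * (norm h)\<^sup>2)"
        by (simp add: r c_def)
      then have "t * (2 * c * ((a - p) \<bullet> h)) \<le> t * (s - r + t * (c * (norm h)\<^sup>2))"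
        by (simp add: algebra_simps power2_eq_square)
      then show ?thesis using t by simp
    qed
    have lim: "((\<lambda>t. s - r + t * (c * (norm h)\<^sup>2)) \<longlongrightarrow> s - r + 0 * (c * (norm h)\<^sup>2)) (at_right 0)"
      by (intro tendsto_intros)
    have "\<forall>\<^sub>F t in at_right 0. 2 * c * ((a - p) \<bullet> h) \<le> s - r + t * (c * (norm h)\<^sup>2)"
      using eventually_at_right_real[of 0 1] by (rule eventually_mono) (use step in auto)
    from tendsto_lowerbound[OF lim this] have "2 * c * ((a - p) \<bullet> h) \<le> s - r" by simp
    then have "(1 / \<gamma>) * ((a - p) \<bullet> h) \<le> s - r" using \<gamma> by (simp add: c_def)
    then show ?thesis by (simp add: r real h_def)
  qed (use R_ninf in auto)
  then show ?thesis by (simp add: subdiff_def p_def)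
qed

section \<open>Second-order calculus along affine sets\<close>

lemma gradient_inner:
  assumes "f differentiable (at x)"
  shows "gradient f x \<bullet> h = frechet_derivative f (at x) h"
proof -
  let ?D = "frechet_derivative f (at x)"
  have lin: "linear ?D" using assms by (rule linear_frechet_derivative)
  have "?D h = ?D (\<Sum>i\<in>UNIV. h $ i *\<^sub>R axis i 1)"
    using basis_expansion[of h] by (simp add: scalar_mult_eq_scaleR)
  also have "\<dots> = (\<Sum>i\<in>UNIV. h $ i * ?D (axis i 1))"
    by (simp add: linear_sum[OF lin] linear_scale[OF lin])
  also have "\<dots> = gradient f x \<bullet> h"
    by (simp add: gradient_def inner_vec_def mult.commute)
  finally show ?thesis ..
qed

text \<open>\<open>C2_on\<close> only asserts the existence of derivative maps; this identifies them
  with the concrete \<open>gradient\<close> and \<open>hessian\<close>.\<close>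

lemma C2_on_derivatives:
  fixes f :: "real^'p \<Rightarrow> real"
  assumes f: "C2_on f N" and x: "x \<in> N"
  shows C2_on_has_derivative: "(f has_derivative (\<lambda>h. gradient f x \<bullet> h)) (at x)"
    and C2_on_gradient_has_derivative: "(gradient f has_derivative (*v) (hessian f x)) (at x)"
proof -
  obtain f' f'' where N: "open N"
    and f': "\<And>x. x \<in> N \<Longrightarrow> (f has_derivative blinfun_apply (f' x)) (at x)"
    and f'': "\<And>x. x \<in> N \<Longrightarrow> (f' has_derivative blinfun_apply (f'' x)) (at x)"
    using f unfolding C2_on_def by blast
  have eq: "gradient f z \<bullet> h = blinfun_apply (f' z) h" if "z \<in> N" for z h
    using gradient_inner[OF differentiableI[OF f'[OF that]], of h]
    by (simp flip: frechet_derivative_at[OF f'[OF that]])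
  show "(f has_derivative (\<lambda>h. gradient f x \<bullet> h)) (at x)"
    using f'[OF x] by (simp add: eq[OF x])
  define D where "D = (\<lambda>h. \<chi> i. blinfun_apply (blinfun_apply (f'' x) h) (axis i 1))"
  have "(gradient f has_derivative D) (at x)"
  proof (rule has_derivative_componentwise_within[THEN iffD2], rule ballI)
    fix b :: "real^'p" assume "b \<in> Basis"
    then obtain i where b: "b = axis i 1" by (auto simp: Basis_vec_def)
    have "((\<lambda>z. blinfun_apply (f' z) b) has_derivative (\<lambda>h. blinfun_apply (blinfun_apply (f'' x) h) b)) (at x)"
      by (rule bounded_linear.has_derivative[OF blinfun.bounded_linear_left f''[OF x]])
    then have "((\<lambda>z. gradient f z \<bullet> b) has_derivative (\<lambda>h. blinfun_apply (blinfun_apply (f'' x) h) b)) (at x)"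
      by (rule has_derivative_transform_within_open[OF _ N x]) (simp add: eq)
    then show "((\<lambda>z. gradient f z \<bullet> b) has_derivative (\<lambda>h. D h \<bullet> b)) (at x)"
      by (simp add: D_def b inner_axis)
  qed
  then have "hessian f x = matrix D" "linear D" "(gradient f has_derivative D) (at x)"
    by (simp_all add: hessian_def has_derivative_linear flip: frechet_derivative_at)
  moreover from this(1,2) have "(*v) (hessian f x) = D"
    by (simp add: fun_eq_iff matrix_works)
  ultimately show "(gradient f has_derivative (*v) (hessian f x)) (at x)" by simp
qed

lemma gradient_along_line:
  assumes f: "C2_on f N" and x: "x + s *\<^sub>R t \<in> N"
  shows "((\<lambda>s. f (x + s *\<^sub>R t)) has_real_derivative gradient f (x + s *\<^sub>R t) \<bullet> t) (at s)"
proof -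
  have "((\<lambda>s. x + s *\<^sub>R t) has_derivative (\<lambda>h. h *\<^sub>R t)) (at s)"
    by (auto intro!: derivative_eq_intros)
  from has_derivative_compose[OF this C2_on_has_derivative[OF f x]] show ?thesis
    by (simp add: has_field_derivative_def mult_commute_abs)
qed

lemma line_segment_in_open:
  fixes x t :: "'a::real_normed_vector"
  assumes "open N" "x \<in> N"
  obtains r where "r > 0" "\<And>s. \<bar>s\<bar> < r \<Longrightarrow> x + s *\<^sub>R t \<in> N"
proof -
  have "\<forall>\<^sub>F s in nhds 0. x + s *\<^sub>R t \<in> N"
  proof (rule topological_tendstoD)
    have "((\<lambda>s. x + s *\<^sub>R t) \<longlongrightarrow> x + 0 *\<^sub>R t) (nhds 0)"
      by (intro tendsto_intros filterlim_ident)
    then show "((\<lambda>s. x + s *\<^sub>R t) \<longlongrightarrow> x) (nhds 0)" by simp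
  qed (use assms in auto)
  then show thesis
    using that by (auto simp: eventually_nhds_metric dist_real_def)
qed

text \<open>By the subgradient inequality, \<open>Rt\<close> minus the linear function of
  \<open>g\<close> has a local minimum along the line at \<open>w\<close>, so its derivative in
  direction \<open>t\<close> vanishes.\<close>

lemma subdiff_gradient_inner:
  fixes R :: "real^'p \<Rightarrow> ereal"
  assumes ext: "C2_extension R M N Rt" and w: "w \<in> N" and line: "\<And>s. w + s *\<^sub>R t \<in> M"
    and g: "g \<in> subdiff R w"
  shows "gradient Rt w \<bullet> t = g \<bullet> t"
proof -
  have C2: "C2_on Rt N" and eq: "\<And>z. z \<in> M \<Longrightarrow> z \<in> N \<Longrightarrow> R z = ereal (Rt z)"
    using ext by (auto simp: C2_extension_def)
  have "open N" using C2 by (simp add: C2_on_def)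
  then obtain r where r: "r > 0" "\<And>s. \<bar>s\<bar> < r \<Longrightarrow> w + s *\<^sub>R t \<in> N"
    using line_segment_in_open w by blast
  have D: "((\<lambda>s. Rt (w + s *\<^sub>R t) - s * (g \<bullet> t)) has_real_derivative gradient Rt w \<bullet> t - g \<bullet> t) (at 0)"
    using gradient_along_line[OF C2, of w 0 t] w
    by (auto intro!: derivative_eq_intros)
  have "Rt (w + 0 *\<^sub>R t) - 0 * (g \<bullet> t) \<le> Rt (w + s *\<^sub>R t) - s * (g \<bullet> t)" if "\<bar>0 - s\<bar> < r" for s
  proof -
    have "R w + ereal (g \<bullet> (w + s *\<^sub>R t - w)) \<le> R (w + s *\<^sub>R t)"
      using g unfolding subdiff_def by blast
    then show ?thesis
      using eq[of w] eq[of "w + s *\<^sub>R t"] line[of 0] line[of s] w r(2)[of s] that by simp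
  qed
  then have "gradient Rt w \<bullet> t - g \<bullet> t = 0"
    by (intro DERIV_local_min[OF D r(1)]) blast
  then show ?thesis by simp
qed

text \<open>Along the line, \<open>Rt\<close> agrees with the convex function \<open>R\<close> near
  \<open>w\<close>, so its derivative cannot decrease to the right of 0, whereas a negative second
  derivative would force a strict decrease.\<close>

lemma convex_hessian_nonneg:
  fixes R :: "real^'p \<Rightarrow> ereal"
  assumes R: "convex_fun R" and ext: "C2_extension R M N Rt"
    and w: "w \<in> N" and line: "\<And>s. w + s *\<^sub>R t \<in> M"
  shows "0 \<le> t \<bullet> (hessian Rt w *v t)"
proof (rule ccontr)
  assume neg: "\<not> ?thesis"
  have C2: "C2_on Rt N" and eq: "\<And>z. z \<in> M \<Longrightarrow> z \<in> N \<Longrightarrow> R z = ereal (Rt z)"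
    using ext by (auto simp: C2_extension_def)
  have "open N" using C2 by (simp add: C2_on_def)
  then obtain r where r: "r > 0" "\<And>s. \<bar>s\<bar> < r \<Longrightarrow> w + s *\<^sub>R t \<in> N"
    using line_segment_in_open w by blast
  define \<phi> where "\<phi> = (\<lambda>s. Rt (w + s *\<^sub>R t))"
  define \<phi>' where "\<phi>' = (\<lambda>s. gradient Rt (w + s *\<^sub>R t) \<bullet> t)"
  have R_line: "R (w + s *\<^sub>R t) = ereal (\<phi> s)" if "\<bar>s\<bar> < r" for s
    using eq[OF line r(2)[OF that]] by (simp add: \<phi>_def)
  have D: "(\<phi> has_real_derivative \<phi>' s) (at s)" if "\<bar>s\<bar> < r" for s
    unfolding \<phi>_def \<phi>'_def using gradient_along_line[OF C2 r(2)[OF that]] .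
  have conv: "convex_on {-r<..<r} \<phi>"
  proof (intro convex_onI convex_real_interval)
    fix u x y :: real assume u: "0 < u" "u < 1" and xy: "x \<in> {-r<..<r}" "y \<in> {-r<..<r}"
    have "(1 - u) *\<^sub>R x + u *\<^sub>R y \<in> {-r<..<r}"
      using xy u by (intro convexD_alt convex_real_interval) auto
    then have z: "\<bar>(1 - u) * x + u * y\<bar> < r" by auto
    have "(1 - u) *\<^sub>R (w + x *\<^sub>R t) + u *\<^sub>R (w + y *\<^sub>R t) = w + ((1 - u) * x + u * y) *\<^sub>R t"
      by (simp add: algebra_simps)
    then show "\<phi> ((1 - u) *\<^sub>R x + u *\<^sub>R y) \<le> (1 - u) * \<phi> x + u * \<phi> y"
      using R[unfolded convex_fun_def, rule_format, of u "w + x *\<^sub>R t" "w + y *\<^sub>R t"] u xy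
        R_line[of x] R_line[of y] R_line[OF z] by (simp add: abs_less_iff)
  qed
  \<comment> \<open>The tangent inequalities at 0 and at \<open>s\<close> together give monotonicity
    of the derivative.\<close>
  have tangent: "\<phi>' x * (y - x) \<le> \<phi> y - \<phi> x" if "\<bar>x\<bar> < r" "\<bar>y\<bar> < r" for x y
    using that D[OF that(1)]
    by (intro convex_on_imp_above_tangent[OF conv])
      (auto simp: interior_open abs_less_iff intro: has_field_derivative_at_within)
  have mono: "\<phi>' 0 \<le> \<phi>' s" if "0 < s" "s < r" for s
  proof -
    have "\<phi>' 0 * s \<le> \<phi> s - \<phi> 0" using tangent[of 0 s] that by simp
    also have "\<dots> \<le> \<phi>' s * s" using tangent[of s 0] that by simp
    finally show ?thesis using that by simp
  qed
  have "((\<lambda>s. w + s *\<^sub>R t) has_derivative (\<lambda>h. h *\<^sub>R t)) (at 0)"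
    by (auto intro!: derivative_eq_intros)
  moreover have "(gradient Rt has_derivative (*v) (hessian Rt w)) (at (w + 0 *\<^sub>R t))"
    using C2_on_gradient_has_derivative[OF C2 w] by simp
  ultimately have "((\<lambda>s. gradient Rt (w + s *\<^sub>R t)) has_derivative (\<lambda>h. hessian Rt w *v (h *\<^sub>R t))) (at 0)"
    by (rule has_derivative_compose)
  then have "(\<phi>' has_derivative (\<lambda>h. (hessian Rt w *v (h *\<^sub>R t)) \<bullet> t)) (at 0)"
    unfolding \<phi>'_def by (rule has_derivative_inner_left)
  moreover have "(\<lambda>h. (hessian Rt w *v (h *\<^sub>R t)) \<bullet> t) = (*) (t \<bullet> (hessian Rt w *v t))"
    by (auto simp: matrix_vector_mult_scaleR inner_commute)
  ultimately have "(\<phi>' has_real_derivative t \<bullet> (hessian Rt w *v t)) (at 0)"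
    by (simp add: has_field_derivative_def)
  from DERIV_neg_dec_right[OF this] neg obtain d
    where d: "d > 0" "\<And>h. 0 < h \<Longrightarrow> h < d \<Longrightarrow> \<phi>' (0 + h) < \<phi>' 0" by auto
  define s where "s = min (d / 2) (r / 2)"
  have "0 < s" "s < d" "s < r" using d(1) r(1) by (auto simp: s_def)
  then show False using d(2)[of s] mono[of s] by simp
qed

text \<open>Subtracting the linearization leaves a map with derivative zero at \<open>a\<close>, and
  for such a map the definition of the derivative is the required limit.\<close>

lemma little_o_along_linear_remainder:
  assumes f: "(f has_derivative D) (at a)" and L: "bounded_linear L"
  shows "little_o_along M a (\<lambda>w. L (f w - f a - D (w - a)))"
proof -
  interpret D: bounded_linear D using f by (rule has_derivative_bounded_linear)
  interpret L: bounded_linear L by (rule L)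
  have "((\<lambda>w. f w - f a - D (w - a)) has_derivative (\<lambda>h. D h - 0 - D (h - 0))) (at a)"
    by (intro has_derivative_diff f has_derivative_const D.has_derivative has_derivative_ident)
  from L.has_derivative[OF this]
  have "((\<lambda>w. L (f w - f a - D (w - a))) has_derivative (\<lambda>h. 0)) (at a within M)"
    by (simp add: L.zero has_derivative_at_withinI)
  then show ?thesis
    by (simp add: has_derivative_iff_norm little_o_along_def D.zero L.zero)
qed

text \<open>Supplies the constants of the rate estimates. The sum of all ratios dominates each of
  them; the summand 1 keeps the constant positive.\<close>

lemma finite_positive_majorant:
  fixes f g :: "'a \<Rightarrow> real"
  assumes "finite F" and "\<And>k. k \<in> F \<Longrightarrow> f k > 0"
  shows "\<exists>C>0. \<forall>k\<in>F. g k \<le> C * f k"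
proof -
  define C where "C = 1 + (\<Sum>k\<in>F. \<bar>g k\<bar> / f k)"
  have "g k \<le> C * f k" if k: "k \<in> F" for k
  proof -
    have "\<bar>g k\<bar> / f k \<le> C"
      unfolding C_def using member_le_sum[of k F "\<lambda>k. \<bar>g k\<bar> / f k"] assms k by fastforce
    then show ?thesis using assms(2)[OF k] by (simp add: divide_le_eq)
  qed
  moreover have "C > 0"
    unfolding C_def using assms by (intro add_pos_nonneg sum_nonneg) (auto intro: divide_nonneg_pos)
  ultimately show ?thesis by blast
qed

section \<open>Primal dynamics of dual gradient descent\<close>

text \<open>The optimality condition of the proximal step with parameter
  \<open>1 / \<alpha>\<close>; \<open>g\<close> serves to guarantee that the minimizer
  exists.\<close>

lemma dgd_subdiff:
  fixes X :: "real^'p^'n"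
  assumes R: "proper_fun R" "convex_fun R" "lsc_fun R" and g: "g \<in> subdiff R w0" and \<alpha>: "\<alpha> > 0"
  shows "- (transpose X *v dgd_v X R \<alpha> y k) - \<alpha> *\<^sub>R dgd_w X R \<alpha> y k \<in> subdiff R (dgd_w X R \<alpha> y k)"
  using prox_subdiff[OF R g, of "1 / \<alpha>" "(1 / \<alpha>) *\<^sub>R (- (transpose X *v dgd_v X R \<alpha> y k))"] \<alpha>
  by (simp add: dgd_w_def dgd_primal_def scaleR_diff_right del: transpose_matrix_vector)

text \<open>The linear algebra of the recursion, separated from \<open>R\<close>. \<open>H\<close>
  will be the Hessian of the extension at the first iterate of the interval.\<close>

locale riemannian_model =
  fixes X :: "real^'p^'n" and \<alpha> :: real and T :: "(real^'p) set" and H :: "real^'p^'p"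
  assumes X_nonzero: "X \<noteq> 0" and \<alpha>_pos: "\<alpha> > 0" and T: "subspace T"
    and H_nonneg: "\<And>t. t \<in> T \<Longrightarrow> 0 \<le> t \<bullet> (H *v t)"
    and injective: "{w. X *v w = 0} \<inter> T = {0}"
begin

definition P :: "real^'p^'p" where "P = orth_projector T"
text \<open>On the orthogonal complement of \<open>T\<close> this is the identity, so it can be
  inverted on the whole space and the inverse commutes with \<open>P\<close>.\<close>

definition S :: "real^'p^'p" where "S = mat 1 + (1 / \<alpha>) *\<^sub>R (P ** H ** P)"
definition A :: "real^'p^'p" where
  "A = P - (1 / (opnorm X)\<^sup>2) *\<^sub>R (P ** matrix_inv S ** (transpose (X ** P) ** (X ** P)))"

lemmas P_mem = orth_projector_mem[OF T, folded P_def]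
  and P_id = orth_projector_id[OF T, folded P_def]
  and P_sym = orth_projector_sym[OF T, folded P_def]

lemma opnorm_pos: "opnorm X > 0"
proof -
  have "(*v) X \<noteq> (\<lambda>x. 0)"
    using X_nonzero by (metis matrix_eq matrix_vector_mult_0)
  then show ?thesis
    unfolding opnorm_def by (simp add: onorm_pos_lt fun_eq_iff)
qed

lemma S_apply: "S *v v = v + (1 / \<alpha>) *\<^sub>R (P *v (H *v (P *v v)))"
  by (simp add: S_def matrix_vector_mult_add_rdistrib scaleR_matrix_vector_assoc[symmetric]
      matrix_vector_mul_assoc[symmetric])

lemma S_coercive: "(norm v)\<^sup>2 \<le> v \<bullet> (S *v v)"
  using H_nonneg[OF P_mem, of v] \<alpha>_pos
  by (simp add: S_apply inner_add_right power2_norm_eq_inner P_sym[symmetric])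

text \<open>Coercivity makes the kernel trivial, which suffices for a square matrix.\<close>

lemma S_inverse: "matrix_inv S ** S = mat 1" "S ** matrix_inv S = mat 1"
proof -
  have "x = 0" if "S *v x = 0" for x
    using S_coercive[of x] that by simp
  then have "invertible S"
    unfolding invertible_left_inverse matrix_left_invertible_ker by blast
  then have "\<exists>B. S ** B = mat 1 \<and> B ** S = mat 1"
    by (simp add: invertible_def)
  from someI_ex[OF this] show "matrix_inv S ** S = mat 1" "S ** matrix_inv S = mat 1"
    by (simp_all add: matrix_inv_def)
qed

lemma S_inverse_apply: "matrix_inv S *v (S *v v) = v" "S *v (matrix_inv S *v v) = v"
  by (simp_all add: matrix_vector_mul_assoc S_inverse)

lemma P_S_commute: "P *v (S *v v) = S *v (P *v v)"
  by (simp add: S_apply matrix_vector_right_distrib matrix_vector_mult_scaleR P_id P_mem)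

lemma P_S_inverse_commute: "P *v (matrix_inv S *v v) = matrix_inv S *v (P *v v)"
  by (metis P_S_commute S_inverse_apply)

lemma A_apply:
  "A *v v = P *v v - (1 / (opnorm X)\<^sup>2) *\<^sub>R (P *v (matrix_inv S *v (transpose (X ** P) *v (X *v (P *v v)))))"
  by (simp add: A_def matrix_vector_mult_diff_rdistrib scaleR_matrix_vector_assoc[symmetric]
      matrix_vector_mul_assoc[symmetric] del: transpose_matrix_vector)

lemma A_mem: "A *v v \<in> T"
  unfolding A_apply by (intro subspace_diff subspace_scale T P_mem)

lemma transpose_XP_inner: "x \<bullet> (transpose (X ** P) *v z) = (X *v (P *v x)) \<bullet> z"
  by (simp add: dot_lmul_matrix inner_commute[of x] matrix_vector_mul_assoc inner_commute[of z])

lemma transpose_XP: "transpose (X ** P) *v z = P *v (transpose X *v z)"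
proof (rule vector_eq_ldot[THEN iffD1], rule allI)
  fix x
  show "x \<bullet> (transpose (X ** P) *v z) = x \<bullet> (P *v (transpose X *v z))"
    unfolding transpose_XP_inner P_sym[symmetric]
    by (simp add: inner_commute[of _ z] inner_commute[of "P *v x"] dot_lmul_matrix)
qed

text \<open>\<open>P\<close> commutes with \<open>S\<close>, so \<open>S\<close> cancels its inverse
  inside \<open>A\<close>; the remaining projectors act trivially on \<open>x\<close> and
  \<open>u\<close>.\<close>

lemma S_A_inner:
  assumes "x \<in> T" "u \<in> T"
  shows "x \<bullet> (S *v (A *v u)) = x \<bullet> (S *v u) - (1 / (opnorm X)\<^sup>2) * ((X *v x) \<bullet> (X *v u))"
proof -
  have "S *v (A *v u) = S *v u - (1 / (opnorm X)\<^sup>2) *\<^sub>R (P *v (transpose (X ** P) *v (X *v u)))"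
    by (simp add: A_apply P_id[OF assms(2)] matrix_vector_mult_diff_distrib matrix_vector_mult_scaleR
        P_S_commute[symmetric] S_inverse_apply del: transpose_matrix_vector)
  then show ?thesis
    by (simp add: inner_diff_right P_sym[symmetric] P_id assms transpose_XP_inner del: transpose_matrix_vector)
qed

lemma spectral_radius_A: "spectral_radius A < 1"
proof (rule spectral_radius_less_one[where S = S and Q = "(1 / opnorm X) *\<^sub>R X"])
  have bound: "norm (X *v u) \<le> opnorm X * norm u" for u
    unfolding opnorm_def by (rule onorm) simp
  fix x u assume "u \<in> T"
  show "norm (((1 / opnorm X) *\<^sub>R X) *v u) \<le> norm u"
    using bound[of u] opnorm_pos by (simp add: scaleR_matrix_vector_assoc[symmetric] field_simps)
  show "((1 / opnorm X) *\<^sub>R X) *v u = 0 \<Longrightarrow> u = 0"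
    using injective \<open>u \<in> T\<close> opnorm_pos by (auto simp: scaleR_matrix_vector_assoc[symmetric])
  assume "x \<in> T"
  then show "x \<bullet> (S *v (A *v u)) = x \<bullet> (S *v u) - (((1 / opnorm X) *\<^sub>R X) *v x) \<bullet> (((1 / opnorm X) *\<^sub>R X) *v u)"
    using S_A_inner[of x u] \<open>u \<in> T\<close>
    by (simp add: scaleR_matrix_vector_assoc[symmetric] power2_eq_square)
qed (use T A_mem S_coercive in auto)

text \<open>Eliminating the dual variable: two consecutive optimality conditions, differenced once more,
  turn the dual gradient step into a linear recursion for the primal increments.\<close>

lemma second_difference_recursion:
  fixes w v r :: "nat \<Rightarrow> _" and w0 :: "real^'p"
  assumes k: "k > 0"
    and step: "\<And>j. v (Suc j) = v j + (\<alpha> / (opnorm X)\<^sup>2) *\<^sub>R (X *v w j - y)"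
    and optimality: "\<And>j. j \<in> {k - 1, k, k + 1} \<Longrightarrow>
      P *v (- (transpose X *v v j) - \<alpha> *\<^sub>R w j) = b + P *v (H *v (w j - w0)) + r j"
    and tangent: "w k - w (k - 1) \<in> T" "w (k + 1) - w k \<in> T"
  shows "w (k + 1) - w k = A *v (w k - w (k - 1)) -
    (1 / \<alpha>) *\<^sub>R (matrix_inv S *v (r (k + 1) - 2 *\<^sub>R r k + r (k - 1)))"
proof -
  define d where "d = w k - w (k - 1)"
  define d' where "d' = w (k + 1) - w k"
  define G where "G = (1 / (opnorm X)\<^sup>2) *\<^sub>R (P *v (transpose X *v (X *v d)))"
  define \<rho> where "\<rho> = r (k + 1) - 2 *\<^sub>R r k + r (k - 1)"
  \<comment> \<open>With \<open>k\<close> positive the truncated \<open>k - 1\<close> is a true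
    predecessor, so the dual step can be used at \<open>k - 1\<close>.\<close>
  have k': "Suc (k - 1) = k" using k by simp
  have dd: "d \<in> T" "d' - d \<in> T"
    using tangent subspace_diff[OF T] unfolding d_def d'_def by blast+
  \<comment> \<open>In the second difference of the dual iterates the data \<open>y\<close> cancel
    and only the primal increment \<open>d\<close> remains.\<close>
  have "v (k + 1) - 2 *\<^sub>R v k + v (k - 1) = (v (k + 1) - v k) - (v k - v (k - 1))"
    by (simp add: scaleR_2)
  also have "\<dots> = (\<alpha> / (opnorm X)\<^sup>2) *\<^sub>R (X *v w k - y) - (\<alpha> / (opnorm X)\<^sup>2) *\<^sub>R (X *v w (k - 1) - y)"
    using step[of k] step[of "k - 1"] unfolding k' by simp
  also have "\<dots> = (\<alpha> / (opnorm X)\<^sup>2) *\<^sub>R (X *v d)"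
    by (simp add: d_def matrix_vector_mult_diff_distrib flip: scaleR_diff_right)
  finally have v2: "v (k + 1) - 2 *\<^sub>R v k + v (k - 1) = (\<alpha> / (opnorm X)\<^sup>2) *\<^sub>R (X *v d)" .
  have w2: "d' - d = w (k + 1) - 2 *\<^sub>R w k + w (k - 1)"
    unfolding d_def d'_def by (simp add: scaleR_2)
  have lin: "B *v (x - 2 *\<^sub>R x' + x'') = B *v x - 2 *\<^sub>R (B *v x') + B *v x''"
    for B :: "real^'a^'b" and x x' x''
    by (simp add: matrix_vector_right_distrib matrix_vector_mult_diff_distrib matrix_vector_mult_scaleR)
  have "- (transpose X *v (v (k + 1) - 2 *\<^sub>R v k + v (k - 1))) - \<alpha> *\<^sub>R (d' - d) =
      (- (transpose X *v v (k + 1)) - \<alpha> *\<^sub>R w (k + 1))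
      - 2 *\<^sub>R (- (transpose X *v v k) - \<alpha> *\<^sub>R w k)
      + (- (transpose X *v v (k - 1)) - \<alpha> *\<^sub>R w (k - 1))"
    unfolding w2 lin by (simp add: algebra_simps del: transpose_matrix_vector)
  \<comment> \<open>The optimality conditions are combined with weights 1, -2, 1, which sum to 0, so
    \<open>b\<close> and the base point \<open>w0\<close> drop out.\<close>
  then have "P *v (- (transpose X *v (v (k + 1) - 2 *\<^sub>R v k + v (k - 1))) - \<alpha> *\<^sub>R (d' - d)) =
      (b + P *v (H *v (w (k + 1) - w0)) + r (k + 1)) - 2 *\<^sub>R (b + P *v (H *v (w k - w0)) + r k)
      + (b + P *v (H *v (w (k - 1) - w0)) + r (k - 1))"
    using optimality[of "k + 1"] optimality[of k] optimality[of "k - 1"] by (simp only: lin) simp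
  also have "\<dots> = P *v (H *v (d' - d)) + \<rho>"
    unfolding w2 lin \<rho>_def
    by (simp add: matrix_vector_mult_diff_distrib scaleR_2 algebra_simps)
  finally have "P *v (- (transpose X *v (v (k + 1) - 2 *\<^sub>R v k + v (k - 1))) - \<alpha> *\<^sub>R (d' - d)) =
      P *v (H *v (d' - d)) + \<rho>" .
  then have "- \<alpha> *\<^sub>R G - \<alpha> *\<^sub>R (P *v (d' - d)) = P *v (H *v (d' - d)) + \<rho>"
    unfolding v2 G_def
    by (simp add: matrix_vector_right_distrib matrix_vector_mult_diff_distrib
        matrix_vector_mult_scaleR linear_neg[OF matrix_vector_mul_linear] del: transpose_matrix_vector)
  then have "P *v (H *v (d' - d)) = - \<alpha> *\<^sub>R G - \<alpha> *\<^sub>R (d' - d) - \<rho>"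
    unfolding P_id[OF dd(2)] by (simp add: algebra_simps)
  \<comment> \<open>Dividing by \<open>\<alpha>\<close> and adding \<open>d' - d\<close> turns the
    Hessian term into \<open>S\<close>.\<close>
  then have "S *v (d' - d) = - G - (1 / \<alpha>) *\<^sub>R \<rho>"
    using \<alpha>_pos by (simp add: S_apply P_id[OF dd(2)] scaleR_diff_right)
  then have "d' - d = matrix_inv S *v (- G - (1 / \<alpha>) *\<^sub>R \<rho>)"
    by (metis S_inverse_apply(1))
  also have "\<dots> = - (matrix_inv S *v G) - (1 / \<alpha>) *\<^sub>R (matrix_inv S *v \<rho>)"
    by (simp add: matrix_vector_mult_diff_distrib matrix_vector_mult_scaleR linear_neg[OF matrix_vector_mul_linear])
  finally have "d' = d - matrix_inv S *v G - (1 / \<alpha>) *\<^sub>R (matrix_inv S *v \<rho>)" by (simp add: algebra_simps)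
  moreover have "A *v d = d - matrix_inv S *v G"
    by (simp add: A_apply P_id[OF dd(1)] G_def P_S_inverse_commute transpose_XP P_id[OF P_mem]
        matrix_vector_mult_scaleR del: transpose_matrix_vector)
  ultimately show ?thesis by (simp add: d_def d'_def \<rho>_def)
qed

end

section \<open>Assembly of the four claims at a fixed noise level\<close>

lemma M_DGD_eq:
  assumes "riemannian_model X \<alpha> T (hessian Rt w)"
  shows "M_DGD X \<alpha> T Rt w = riemannian_model.A X \<alpha> T (hessian Rt w)"
  by (simp add: M_DGD_def riemannian_hessian_def Let_def riemannian_model.A_def[OF assms]
      riemannian_model.S_def[OF assms] riemannian_model.P_def[OF assms])

theorem theorem5p1:
  fixes X :: "real^'p^'n"
    and wd :: "real^'p" and yd :: "real^'n"
    and y :: "real \<Rightarrow> real^'n"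
    and R :: "real^'p \<Rightarrow> ereal"
    and \<alpha> c \<epsilon> cbar :: real
    and kstop :: "real \<Rightarrow> nat" and cstop :: "real \<Rightarrow> real"
    and vd :: "real^'n" and zd :: "real^'p"
    and T M U :: "(real^'p) set"
  assumes X_nonzero: "X \<noteq> 0"
    and yd_def: "yd = X *v wd"
    and noise: "\<And>\<delta>. 0 < \<delta> \<Longrightarrow> \<delta> < 1 \<Longrightarrow> y \<delta> \<in> range ((*v) X) \<and> norm (y \<delta> - yd) \<le> \<delta>"
    and R: "proper_fun R" "convex_fun R" "lsc_fun R"
    and \<alpha>_pos: "\<alpha> > 0"
    and c_pos: "c > 0"
    and early_stopping: "\<And>\<delta>. 0 < \<delta> \<Longrightarrow> \<delta> < 1 \<Longrightarrow> \<delta> \<le> c \<Longrightarrow>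
          int (kstop \<delta>) \<in> {\<lfloor>c * inverse \<delta>\<rfloor>..2 * \<lfloor>c * inverse \<delta>\<rfloor>} \<and>
          cstop \<delta> > 0 \<and> real (kstop \<delta>) = cstop \<delta> * inverse \<delta>"
    and a_primal: "{w. is_arg_min (regularized \<alpha> R) (\<lambda>w. X *v w = yd) w} = {wd}"
    and a_dual: "is_arg_min (\<lambda>v. conjugate (regularized \<alpha> R) (- (transpose X *v v)) + ereal (yd \<bullet> v))
          (\<lambda>_. True) vd"
    and a_conv: "dgd_v X R \<alpha> yd \<longlonglongrightarrow> vd"
    and zd_def: "zd = - (transpose X *v vd)"
    and b: "zd \<in> rel_interior (subdiff (regularized \<alpha> R) wd)"
    and T_def: "T = model_space R wd"
    and c_partly_smooth: "partly_smooth R wd M"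
    and c_affine: "M = (\<lambda>t. wd + t) ` T"
    and d_eps: "\<epsilon> > 0"
    and d_U: "U = (\<Union>w\<in>M \<inter> ball wd \<epsilon>. (\<lambda>g. w + g) ` subdiff (regularized \<alpha> R) w)"
    and d_bound: "\<forall>\<^sub>F \<delta> in at_right 0. cstop \<delta> \<le> cbar"
    and d_dist: "ereal (\<alpha> * cbar * inverse (opnorm X)) < edist_set (wd + zd) (frontier U)"
    and e: "{w. X *v w = 0} \<inter> T = {0}"
  shows "\<forall>\<^sub>F \<delta> in at_right 0. \<forall>klo khi N Rt.
     (let w = dgd_w X R \<alpha> (y \<delta>);
          k\<delta> = kstop \<delta>;
          A = M_DGD X \<alpha> T Rt (w klo)
      in 0 < klo \<and> klo < k\<delta> \<and> k\<delta> < khi \<and>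
         wd \<in> N \<and> C2_extension R M N Rt \<and>
         (\<forall>k\<in>{klo..khi}. w k \<in> M \<inter> N) \<and>
         norm (w k\<delta> - wd) = (MIN k\<in>{klo..khi}. norm (w k - wd))
         \<longrightarrow>
         spectral_radius A < 1 \<and>
         (\<exists>\<phi>1 \<phi>2 \<phi>3 :: real^'p \<Rightarrow> real^'p.
            little_o_along M (w klo) \<phi>1 \<and> little_o_along M (w klo) \<phi>2 \<and>
            little_o_along M (w klo) \<phi>3 \<and>
            (\<forall>k. {k - 1, k, k + 1} \<subseteq> {klo..khi} \<longrightarrow>
               w (k + 1) - w k = A *v (w k - w (k - 1))
                 + (\<phi>1 (w (k + 1)) + \<phi>2 (w k) + \<phi>3 (w (k - 1))))) \<and>
         (card {klo..khi} > 3 \<longrightarrow>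
            (\<forall>\<rho>. spectral_radius A < \<rho> \<and> \<rho> < 1 \<longrightarrow>
               (\<exists>C>0. \<forall>k\<in>{klo..<khi}. norm (w (k + 1) - w k) \<le> C * \<rho> ^ (k - klo)))) \<and>
         (\<forall>\<rho>. spectral_radius A < \<rho> \<and> \<rho> < 1 \<longrightarrow>
            (\<exists>D>0. \<forall>k\<in>{klo..khi}.
               norm (w k - wd) \<le> norm (w k\<delta> - wd)
                 + D * \<rho> ^ (min k k\<delta> - klo)
                     * ((1 - \<rho> ^ nat \<bar>int k - int k\<delta>\<bar>) / (1 - \<rho>)))))"
proof (unfold Let_def, rule always_eventually, intro allI impI, elim conjE, goal_cases)
  case (1 \<delta> klo khi N Rt)
  define w where "w = dgd_w X R \<alpha> (y \<delta>)"
  define v where "v = dgd_v X R \<alpha> (y \<delta>)"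
  define MD where "MD = M_DGD X \<alpha> T Rt (w klo)"
  let ?k\<delta> = "kstop \<delta>"
  have interval: "0 < klo" "klo < ?k\<delta>" "?k\<delta> < khi"
    and ext: "C2_extension R M N Rt" and w_mem: "\<And>k. k \<in> {klo..khi} \<Longrightarrow> w k \<in> M \<inter> N"
    using 1 by (simp_all add: w_def)
  have T: "subspace T" unfolding T_def model_space_def by (rule subspace_orthogonal_comp)
  obtain g0 where g0: "g0 \<in> subdiff R wd"
    using c_partly_smooth by (auto simp: partly_smooth_def)
  \<comment> \<open>Affineness of \<open>M\<close> enters here: lines in directions of
    \<open>T\<close> stay in \<open>M\<close>, and differences of points of \<open>M\<close> lie in
    \<open>T\<close>.\<close>
  have line: "x + s *\<^sub>R t \<in> M" if x: "x \<in> M" and t: "t \<in> T" for x s t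
  proof -
    obtain u where u: "u \<in> T" "x = wd + u" using x by (auto simp: c_affine)
    then have "u + s *\<^sub>R t \<in> T" using T t by (intro subspace_add subspace_scale)
    then show ?thesis unfolding c_affine by (rule rev_image_eqI) (simp add: u add.assoc)
  qed
  have diff: "x - x' \<in> T" if "x \<in> M" "x' \<in> M" for x x'
    using that T by (auto simp: c_affine intro: subspace_diff)
  have w0: "w klo \<in> M" "w klo \<in> N" using w_mem[of klo] interval by auto
  define H where "H = hessian Rt (w klo)"
  interpret riemannian_model X \<alpha> T H
    using X_nonzero \<alpha>_pos T e convex_hessian_nonneg[OF R(2) ext w0(2) line[OF w0(1)]]
    by unfold_locales (simp_all add: H_def)
  have MD_eq: "MD = riemannian_model.A X \<alpha> T H"
    unfolding MD_def H_def by (rule M_DGD_eq) (use riemannian_model_axioms in \<open>simp add: H_def\<close>)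
  \<comment> \<open>The first-order Taylor remainder of the gradient at the first iterate of the
    interval.\<close>
  define E where "E = (\<lambda>x. gradient Rt x - gradient Rt (w klo) - H *v (x - w klo))"
  have optimality: "P *v (- (transpose X *v v j) - \<alpha> *\<^sub>R w j) =
      P *v gradient Rt (w klo) + P *v (H *v (w j - w klo)) + P *v E (w j)"
    if j: "j \<in> {klo..khi}" for j
  proof -
    define g where "g = - (transpose X *v v j) - \<alpha> *\<^sub>R w j"
    have "g \<in> subdiff R (w j)"
      unfolding g_def v_def w_def by (rule dgd_subdiff[OF R g0 \<alpha>_pos])
    then have "gradient Rt (w j) \<bullet> t = g \<bullet> t" if "t \<in> T" for t
      using w_mem[OF j] that by (intro subdiff_gradient_inner[OF ext]) (auto intro: line)
    \<comment> \<open>Both vectors have the same inner products with all of \<open>T\<close>, hence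
      the same projection.\<close>
    then have "P *v gradient Rt (w j) = P *v g"
      by (subst vector_eq_rdot[symmetric]) (simp add: P_sym P_mem)
    then show ?thesis
      unfolding g_def[symmetric] by (simp add: E_def flip: matrix_vector_right_distrib)
  qed
  \<comment> \<open>The free scalar \<open>a\<close> covers all three remainders: the weights 1, -2,
    1 times \<open>- 1 / \<alpha>\<close>.\<close>
  have little_o: "little_o_along M (w klo) (\<lambda>x. a *\<^sub>R ((matrix_inv S ** P) *v E x))" for a
    unfolding E_def H_def
    by (intro little_o_along_linear_remainder C2_on_gradient_has_derivative[OF _ w0(2)]
        bounded_linear_compose[OF bounded_linear_scaleR_right matrix_vector_mul_bounded_linear])
      (use ext in \<open>simp add: C2_extension_def\<close>)
  have recursion: "w (k + 1) - w k = MD *v (w k - w (k - 1))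
      + ((- 1 / \<alpha>) *\<^sub>R ((matrix_inv S ** P) *v E (w (k + 1)))
         + (2 / \<alpha>) *\<^sub>R ((matrix_inv S ** P) *v E (w k))
         + (- 1 / \<alpha>) *\<^sub>R ((matrix_inv S ** P) *v E (w (k - 1))))"
    if k: "{k - 1, k, k + 1} \<subseteq> {klo..khi}" for k
  proof -
    have "w (k + 1) - w k = MD *v (w k - w (k - 1)) - (1 / \<alpha>) *\<^sub>R (matrix_inv S *v
        (P *v E (w (k + 1)) - 2 *\<^sub>R (P *v E (w k)) + P *v E (w (k - 1))))"
      unfolding MD_eq
    proof (rule second_difference_recursion[where v = v and y = "y \<delta>" and w = w
          and r = "\<lambda>j. P *v E (w j)"])
      show "v (Suc j) = v j + (\<alpha> / (opnorm X)\<^sup>2) *\<^sub>R (X *v w j - y \<delta>)" for j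
        by (simp add: v_def w_def dgd_w_def)
    qed (use k interval diff w_mem optimality in auto)
    then show ?thesis
      by (simp add: matrix_vector_right_distrib matrix_vector_mult_diff_distrib
          matrix_vector_mult_scaleR algebra_simps flip: matrix_vector_mul_assoc)
  qed
  have rates: "\<exists>C>0. \<forall>k\<in>{klo..<khi}. norm (w (k + 1) - w k) \<le> C * \<rho> ^ (k - klo)"
    "\<exists>D>0. \<forall>k\<in>{klo..khi}. norm (w k - wd) \<le> norm (w ?k\<delta> - wd) + D * \<rho> ^ (min k ?k\<delta> - klo)
       * ((1 - \<rho> ^ nat \<bar>int k - int ?k\<delta>\<bar>) / (1 - \<rho>))"
    if \<rho>: "spectral_radius MD < \<rho>" "\<rho> < 1" for \<rho>
  proof -
    have \<rho>_pos: "0 < \<rho>" using \<rho> spectral_radius_nonneg[of MD] by simp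
    then show "\<exists>C>0. \<forall>k\<in>{klo..<khi}. norm (w (k + 1) - w k) \<le> C * \<rho> ^ (k - klo)"
      by (intro finite_positive_majorant) auto
    \<comment> \<open>This bound vanishes at \<open>k = ?k\<delta>\<close>, where the claim holds
      with equality. The constant \<open>D\<close> is therefore chosen over the other indices, where
      \<open>?f\<close> is positive.\<close>
    let ?f = "\<lambda>k. \<rho> ^ (min k ?k\<delta> - klo) * ((1 - \<rho> ^ nat \<bar>int k - int ?k\<delta>\<bar>) / (1 - \<rho>))"
    have "?f k > 0" if "k \<noteq> ?k\<delta>" for k
      using \<rho> \<rho>_pos that by (intro mult_pos_pos divide_pos_pos) (auto simp: power_less_one_iff)
    then have "\<exists>D>0. \<forall>k\<in>{klo..khi} - {?k\<delta>}. norm (w k - wd) - norm (w ?k\<delta> - wd) \<le> D * ?f k"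
      by (intro finite_positive_majorant) auto
    then obtain D where D: "D > 0" "\<And>k. k \<in> {klo..khi} - {?k\<delta>} \<Longrightarrow>
        norm (w k - wd) - norm (w ?k\<delta> - wd) \<le> D * ?f k"
      by blast
    have "norm (w k - wd) \<le> norm (w ?k\<delta> - wd) + D * \<rho> ^ (min k ?k\<delta> - klo)
        * ((1 - \<rho> ^ nat \<bar>int k - int ?k\<delta>\<bar>) / (1 - \<rho>))" if "k \<in> {klo..khi}" for k
    proof (cases "k = ?k\<delta>")
      case False
      then show ?thesis using D(2)[of k] that by (simp add: mult.assoc)
    qed simp
    then show "\<exists>D>0. \<forall>k\<in>{klo..khi}. norm (w k - wd) \<le> norm (w ?k\<delta> - wd) + D * \<rho> ^ (min k ?k\<delta> - klo)
       * ((1 - \<rho> ^ nat \<bar>int k - int ?k\<delta>\<bar>) / (1 - \<rho>))"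
      using D(1) by blast
  qed
  have "spectral_radius MD < 1" unfolding MD_eq by (rule spectral_radius_A)
  then show ?case
    using little_o recursion rates unfolding MD_def w_def by blast
qed

end
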